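(* Let $K$ be a field with $\operatorname{char}K\neq 2$, and let $\mathbf Q$ be the Lie subsuperalgebra of $(\operatorname{End}\Lambda)^{(-)}$ generated by the pivot elements $v_0,v_1,v_2$ (notation in context). Then a basis of $\mathbf Q$ is given by the following standard monomials: (i) (first type) all $r_{n-3}v_n$, $n\ge 0$, where $r_{n-3}$ runs over all tail monomials, except the monomials $x_0x_1^{\xi_1}v_4$ (i.e. length $4$ monomials containing $x_0$) and $x_0x_1^{\xi_1}x_2^{\xi_2}x_3x_4^{\xi_4}v_7$ (i.e. length $7$ monomials containing both $x_0$ and $x_3$), $\xi_j\in\{0,1\}$; (ii) (second type) $x_1v_3,\ x_2v_4,\ x_3v_5$, together with all $r_{n-5}x_{n-2}v_n$, $n\ge 6$, where $r_{n-5}$ runs over all tail monomials, except the monomials $x_0x_1^{\xi_1}x_2^{\xi_2}x_5v_7$ and $x_0x_1^{\xi_1}x_2^{\xi_2}x_3x_4^{\xi_4}x_5x_8v_{10}$, $\xi_j\in\{0,1\}$.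
   Context: $\Lambda$ is the Grassmann algebra over $K$ on odd generators $x_0,x_1,\dots$; $x_i$ is identified with left multiplication by $x_i$ on $\Lambda$; $\partial_i$ is the odd superderivation with $\partial_i(x_j)=\delta_{ij}$. The pivot elements are $v_i=\sum_{k\ge0}\big(\prod_{n=0}^{k-1}x_{i+3n}x_{i+3n+1}\big)\partial_{i+3k}$ ($i\ge0$), well-defined odd superderivations of $\Lambda$. $(\operatorname{End}\Lambda)^{(-)}$ is the Lie superalgebra with supercommutator $[a,b]=ab-(-1)^{|a||b|}ba$. A tail monomial is $r_m=x_0^{\xi_0}x_1^{\xi_1}\cdots x_m^{\xi_m}$ with $\xi_i\in\{0,1\}$ (for $m<0$, $r_m=1$); the monomials above are compositions of operators in $\operatorname{End}\Lambda$. *)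

theory Defs
  imports Complex_Main "HOL-Library.Function_Algebras"
begin

text \<open>The Grassmann algebra Lambda over K on odd generators x_0, x_1, ... has the K-basis
  of monomials x_S = x_{s_1} x_{s_2} ... x_{s_k} (s_1 < ... < s_k), S a finite set of naturals.
  A linear operator A in End Lambda is represented by its matrix:
  A S T = coefficient of x_T in A(x_S).  Rows for infinite S are kept zero.\<close>

type_synonym 'k op = "nat set \<Rightarrow> nat set \<Rightarrow> 'k"

definition op_scale :: "'k::field \<Rightarrow> 'k op \<Rightarrow> 'k op" where
  "op_scale c A = (\<lambda>S T. c * A S T)"

definition op_comp :: "'k::field op \<Rightarrow> 'k op \<Rightarrow> 'k op" where
  "op_comp A B = (\<lambda>S U. \<Sum>T\<in>{T. B S T \<noteq> 0}. B S T * A T U)"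

definition op_id :: "'k::field op" where
  "op_id = (\<lambda>S T. if finite S \<and> T = S then 1 else 0)"

text \<open>Left multiplication by x_i.\<close>
definition xop :: "nat \<Rightarrow> 'k::field op" where
  "xop i = (\<lambda>S T. if finite S \<and> i \<notin> S \<and> T = insert i S
                   then (-1) ^ card {j\<in>S. j < i} else 0)"

text \<open>The odd superderivation partial_i with partial_i(x_j) = delta_ij.\<close>
definition dop :: "nat \<Rightarrow> 'k::field op" where
  "dop i = (\<lambda>S T. if finite S \<and> i \<in> S \<and> T = S - {i}
                   then (-1) ^ card {j\<in>S. j < i} else 0)"

definition op_prod :: "'k::field op list \<Rightarrow> 'k op" where
  "op_prod As = foldr op_comp As op_id"

definition xmon :: "nat list \<Rightarrow> 'k::field op" where
  "xmon js = op_prod (map xop js)"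

definition pivot_coeff :: "nat \<Rightarrow> nat \<Rightarrow> 'k::field op" where
  "pivot_coeff i k = xmon (concat (map (\<lambda>n. [i + 3*n, i + 3*n + 1]) [0..<k]))"

text \<open>Pivot element v_i = sum_{k>=0} (prod_{n<k} x_{i+3n} x_{i+3n+1}) partial_{i+3k}.
  On each basis monomial x_S only the finitely many terms with i+3k in S are nonzero,
  so the infinite sum is computed as this (finite) pointwise sum.\<close>
definition pivot :: "nat \<Rightarrow> 'k::field op" where
  "pivot i = (\<lambda>S T. \<Sum>k\<in>{k. i + 3*k \<in> S}. op_comp (pivot_coeff i k) (dop (i + 3*k)) S T)"

text \<open>Supercommutator of homogeneous operators of parities p, q (True = odd):
  [A,B] = AB - (-1)^{|A||B|} BA.\<close>
definition sbr :: "bool \<Rightarrow> bool \<Rightarrow> 'k::field op \<Rightarrow> 'k op \<Rightarrow> 'k op" where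
  "sbr p q A B = (\<lambda>S T. op_comp A B S T - (if p \<and> q then -1 else 1) * op_comp B A S T)"

inductive bracket_word :: "'k::field op \<Rightarrow> bool \<Rightarrow> bool" where
  gen: "i \<le> 2 \<Longrightarrow> bracket_word (pivot i) True"
| br: "bracket_word A p \<Longrightarrow> bracket_word B q \<Longrightarrow> bracket_word (sbr p q A B) (p \<noteq> q)"

text \<open>The Lie subsuperalgebra Q of (End Lambda)^(-) generated by v_0, v_1, v_2:
  the K-span of all iterated supercommutators of the generators.\<close>
definition Qalg :: "'k::field op set" where
  "Qalg = module.span op_scale {A. \<exists>p. bracket_word A p}"

text \<open>Standard monomials of the first type: r_{n-3} v_n, where r_{n-3} = prod_{j in J} x_j
  (increasing order) for J a subset of {0..n-3} (empty if n < 3).\<close>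
definition std1 :: "nat \<Rightarrow> nat set \<Rightarrow> 'k::field op" where
  "std1 n J = op_comp (xmon (sorted_list_of_set J)) (pivot n)"

definition idx1 :: "(nat \<times> nat set) set" where
  "idx1 = {(n, J). J \<subseteq> {0..<n - 2}
                  \<and> \<not> (n = 4 \<and> 0 \<in> J)
                  \<and> \<not> (n = 7 \<and> 0 \<in> J \<and> 3 \<in> J)}"

definition std2 :: "nat \<Rightarrow> nat set \<Rightarrow> 'k::field op" where
  "std2 n J = op_comp (xmon (sorted_list_of_set J @ [n - 2])) (pivot n)"

definition idx2 :: "(nat \<times> nat set) set" where
  "idx2 = {(n, J). (n \<in> {3, 4, 5} \<and> J = {})
                 \<or> (6 \<le> n \<and> J \<subseteq> {0..<n - 4}
                    \<and> \<not> (n = 7 \<and> 0 \<in> J)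
                    \<and> \<not> (n = 10 \<and> {0, 3, 5} \<subseteq> J))}"

definition std_mon :: "(nat \<times> nat set) + (nat \<times> nat set) \<Rightarrow> 'k::field op" where
  "std_mon a = (case a of Inl (n, J) \<Rightarrow> std1 n J | Inr (n, J) \<Rightarrow> std2 n J)"

definition std_index :: "((nat \<times> nat set) + (nat \<times> nat set)) set" where
  "std_index = idx1 <+> idx2"

end

theory Submission
  imports Defs
begin

text \<open>
  The pivots satisfy \<open>v_n = \<partial>_n + x_n x_{n+1} v_{n+3}\<close>. With it every supercommutator
  \<open>[x_J v_n, x_K v_m]\<close> of standard monomials, \<open>n \<le> m\<close>, reduces to \<open>x_J [v_n, x_K v_m]\<close> and then, by
  descending induction on \<open>n\<close>, to the values \<open>v_m\<^sup>2 = x_{m+1} v_{m+3}\<close> and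
  \<open>[v_m, v_{m+1}] = - x_m v_{m+3}\<close>, which shows that standard monomials span a subalgebra.
  Supercommutators add weights, where \<open>v_n\<close> has weight \<open>\<alpha>_n\<close> and \<open>x_n\<close> has weight \<open>- \<alpha>_n\<close>, with
  \<open>\<alpha>_{n+3} = 2 \<alpha>_n + \<alpha>_{n+1}\<close> and initial values \<open>1, 0, 0\<close>. The generators have nonnegative weight,
  and the exceptions are exactly the monomials of standard shape whose weight is negative.

  Conversely, \<open>[v_n, r v_{n+1}] = \<plusminus> r x_n v_{n+3}\<close>, \<open>[v_n, r v_{n+2}] = \<plusminus> r x_n x_{n+1} x_{n+2} v_{n+5}\<close>,
  \<open>[v_n, r v_n] = \<plusminus> 2 r x_{n+1} v_{n+3}\<close> and \<open>[v_n, r v_{n+3}] = \<plusminus> 2 r x_n x_{n+1} x_{n+4} v_{n+6}\<close>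
  produce the longest standard monomials, and the supercommutator with \<open>v_n\<close> strips a factor \<open>x_n\<close>.
  Linear independence follows by evaluating a relation at \<open>x_n\<close> for the least \<open>n\<close> occurring in it.
\<close>

subsection \<open>The ring of row-finite operators\<close>

text \<open>\<open>op_comp\<close> sums over the support of a row, and a sum over an infinite set is
  0, so finite rows are what secures associativity and distributivity. Vanishing outside finite sets
  makes \<open>op_id\<close> a unit.\<close>

definition row_finite :: "'k::field op \<Rightarrow> bool" where
  "row_finite A \<longleftrightarrow> (\<forall>S. finite {T. A S T \<noteq> 0}) \<and> (\<forall>S T. A S T \<noteq> 0 \<longrightarrow> finite S \<and> finite T)"

lemma row_finiteI:
  "(\<And>S. finite {T. A S T \<noteq> 0}) \<Longrightarrow> (\<And>S T. A S T \<noteq> 0 \<Longrightarrow> finite S \<and> finite T) \<Longrightarrow> row_finite A"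
  by (auto simp: row_finite_def)

lemma row_finite_single:
  assumes "\<And>S T. A S T \<noteq> 0 \<Longrightarrow> finite S \<and> finite T \<and> T = f S"
  shows "row_finite A"
proof (rule row_finiteI)
  fix S
  have "{T. A S T \<noteq> 0} \<subseteq> {f S}" using assms by auto
  then show "finite {T. A S T \<noteq> 0}" by (rule finite_subset) simp
qed (use assms in auto)

lemma op_comp_eq_sum:
  assumes "finite F" "{T. B S T \<noteq> 0} \<subseteq> F"
  shows "op_comp A B S U = (\<Sum>T\<in>F. B S T * A T U)"
  unfolding op_comp_def by (rule sum.mono_neutral_left) (use assms in auto)

lemma op_comp_single:
  assumes "\<And>T. T \<noteq> T0 \<Longrightarrow> B S T = 0"
  shows "op_comp A B S U = B S T0 * A T0 U"
proof -
  have "{T. B S T \<noteq> 0} \<subseteq> {T0}" using assms by blast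
  then show ?thesis using op_comp_eq_sum[of "{T0}" B S A U] by simp
qed

lemma op_comp_nonzero_obtains:
  assumes "op_comp A B S U \<noteq> 0"
  obtains T where "B S T \<noteq> 0" "A T U \<noteq> 0"
proof -
  obtain T where "B S T * A T U \<noteq> 0"
    using assms unfolding op_comp_def by (rule sum.not_neutral_contains_not_neutral)
  then show thesis using that by auto
qed

lemma row_finite_op_comp:
  assumes A: "row_finite A" and B: "row_finite B"
  shows "row_finite (op_comp A B)"
proof (rule row_finiteI)
  fix S
  have "{U. op_comp A B S U \<noteq> 0} \<subseteq> (\<Union>T\<in>{T. B S T \<noteq> 0}. {U. A T U \<noteq> 0})"
    by (auto elim: op_comp_nonzero_obtains)
  moreover have "finite (\<Union>T\<in>{T. B S T \<noteq> 0}. {U. A T U \<noteq> 0})"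
    using A B by (auto simp: row_finite_def)
  ultimately show "finite {U. op_comp A B S U \<noteq> 0}" by (rule finite_subset)
next
  fix S U
  assume "op_comp A B S U \<noteq> 0"
  then obtain T where "B S T \<noteq> 0" "A T U \<noteq> 0" by (rule op_comp_nonzero_obtains)
  then show "finite S \<and> finite U" using A B by (auto simp: row_finite_def)
qed

lemma op_comp_assoc:
  assumes A: "row_finite A" and B: "row_finite B" and C: "row_finite C"
  shows "op_comp (op_comp A B) C = op_comp A (op_comp B C)"
proof (intro ext)
  fix S U
  define F where "F = {T. C S T \<noteq> 0}"
  define G where "G = (\<Union>T\<in>F. {V. B T V \<noteq> 0})"
  have fin: "finite F" "finite G"
    using B C by (auto simp: F_def G_def row_finite_def)
  have BC: "op_comp B C S V = (\<Sum>T\<in>F. C S T * B T V)" for V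
    by (simp add: op_comp_def F_def)
  have "op_comp (op_comp A B) C S U = (\<Sum>T\<in>F. C S T * op_comp A B T U)"
    by (simp add: op_comp_def F_def)
  also have "\<dots> = (\<Sum>T\<in>F. C S T * (\<Sum>V\<in>G. B T V * A V U))"
    by (intro sum.cong refl arg_cong2[where f = "(*)"] op_comp_eq_sum fin) (auto simp: G_def)
  also have "\<dots> = (\<Sum>V\<in>G. \<Sum>T\<in>F. C S T * B T V * A V U)"
    by (simp add: sum_distrib_left mult.assoc sum.swap[of _ G F])
  also have "\<dots> = (\<Sum>V\<in>G. op_comp B C S V * A V U)"
    by (simp add: BC sum_distrib_right)
  also have "\<dots> = op_comp A (op_comp B C) S U"
  proof (rule op_comp_eq_sum[symmetric, OF fin(2)])
    show "{V. op_comp B C S V \<noteq> 0} \<subseteq> G"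
      by (auto simp: G_def F_def elim: op_comp_nonzero_obtains)
  qed
  finally show "op_comp (op_comp A B) C S U = op_comp A (op_comp B C) S U" .
qed

lemma row_finite_add:
  assumes "row_finite A" "row_finite B"
  shows "row_finite (\<lambda>S T. A S T + B S T)"
proof (rule row_finiteI)
  fix S
  have "{T. A S T + B S T \<noteq> 0} \<subseteq> {T. A S T \<noteq> 0} \<union> {T. B S T \<noteq> 0}" by auto
  then show "finite {T. A S T + B S T \<noteq> 0}"
    by (rule finite_subset) (use assms in \<open>auto simp: row_finite_def\<close>)
next
  show "finite S \<and> finite T" if "A S T + B S T \<noteq> 0" for S T
    using that assms by (cases "A S T = 0") (auto simp: row_finite_def)
qed

lemma row_finite_scale: "row_finite A \<Longrightarrow> row_finite (\<lambda>S T. c * A S T)"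
  by (auto simp: row_finite_def)

lemma row_finite_id: "row_finite op_id"
  by (rule row_finite_single[where f = "\<lambda>S. S"]) (auto simp: op_id_def split: if_splits)

lemma op_comp_add_left: "op_comp (\<lambda>S T. A S T + B S T) C = (\<lambda>S T. op_comp A C S T + op_comp B C S T)"
  by (simp add: op_comp_def distrib_left sum.distrib)

lemma op_comp_add_right:
  assumes "row_finite B" "row_finite C"
  shows "op_comp A (\<lambda>S T. B S T + C S T) = (\<lambda>S T. op_comp A B S T + op_comp A C S T)"
proof (intro ext)
  fix S U
  define F where "F = {T. B S T \<noteq> 0} \<union> {T. C S T \<noteq> 0}"
  have F: "finite F" using assms by (auto simp: F_def row_finite_def)
  have "op_comp A D S U = (\<Sum>T\<in>F. D S T * A T U)" if "\<And>T. T \<notin> F \<Longrightarrow> D S T = 0" for D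
    by (rule op_comp_eq_sum[OF F]) (use that in auto)
  then show "op_comp A (\<lambda>S T. B S T + C S T) S U = op_comp A B S U + op_comp A C S U"
    by (auto simp: F_def distrib_right sum.distrib)
qed

lemma op_comp_scale_left: "op_comp (\<lambda>S T. c * A S T) B = (\<lambda>S T. c * op_comp A B S T)"
  by (simp add: op_comp_def sum_distrib_left algebra_simps)

lemma op_comp_scale_right: "op_comp A (\<lambda>S T. c * B S T) = (\<lambda>S T. c * op_comp A B S T)"
  by (cases "c = 0") (simp_all add: op_comp_def sum_distrib_left algebra_simps)

text \<open>On this type composition is the multiplication of a ring, so ring simplification applies
  to operators; \<open>Rep_rop\<close> leads back to matrices.\<close>

typedef (overloaded) 'k rop = "{A :: 'k::field op. row_finite A}"
  by (rule exI[of _ "op_id"]) (simp add: row_finite_id)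

setup_lifting type_definition_rop

instantiation rop :: (field) ring_1
begin

lift_definition zero_rop :: "'a rop" is "\<lambda>S T. 0" by (simp add: row_finite_def)
lift_definition one_rop :: "'a rop" is op_id by (rule row_finite_id)
lift_definition plus_rop :: "'a rop \<Rightarrow> 'a rop \<Rightarrow> 'a rop" is "\<lambda>A B S T. A S T + B S T"
  by (rule row_finite_add)
lift_definition uminus_rop :: "'a rop \<Rightarrow> 'a rop" is "\<lambda>A S T. - A S T"
  by (simp add: row_finite_def)
lift_definition minus_rop :: "'a rop \<Rightarrow> 'a rop \<Rightarrow> 'a rop" is "\<lambda>A B S T. A S T - B S T"
  using row_finite_add[OF _ row_finite_scale[where c = "-1"]] by simp
lift_definition times_rop :: "'a rop \<Rightarrow> 'a rop \<Rightarrow> 'a rop" is op_comp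
  by (rule row_finite_op_comp)

instance
proof
  fix a b c :: "'a rop"
  show "a * b * c = a * (b * c)" by transfer (rule op_comp_assoc)
  show "1 * a = a"
  proof (transfer, intro ext)
    fix A :: "'a op" and S T
    assume A: "row_finite A"
    have "op_comp op_id A S T = (\<Sum>U\<in>{U. A S U \<noteq> 0}. if U = T then A S U else 0)"
      unfolding op_comp_def
      by (rule sum.cong) (use A in \<open>auto simp: op_id_def row_finite_def\<close>)
    also have "\<dots> = A S T"
      using A by (subst sum.delta) (auto simp: row_finite_def)
    finally show "op_comp op_id A S T = A S T" .
  qed
  show "a * 1 = a"
  proof (transfer, intro ext)
    fix A :: "'a op" and S T
    assume A: "row_finite A"
    have "op_comp A op_id S T = op_id S S * A S T"
      by (rule op_comp_single) (auto simp: op_id_def)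
    also have "\<dots> = A S T" using A by (auto simp: op_id_def row_finite_def)
    finally show "op_comp A op_id S T = A S T" .
  qed
  show "(a + b) * c = a * c + b * c" by transfer (rule op_comp_add_left)
  show "a * (b + c) = a * b + a * c" by transfer (rule op_comp_add_right)
  show "a + b + c = a + (b + c)" by transfer (simp add: add.assoc)
  show "a + b = b + a" by transfer (simp add: add.commute)
  show "0 + a = a" by transfer simp
  show "- a + a = 0" by transfer simp
  show "a - b = a + - b" by transfer simp
  have "op_id {} {} \<noteq> (0::'a)" by (simp add: op_id_def)
  then show "(0 :: 'a rop) \<noteq> 1" by transfer metis
qed

end

lift_definition rscale :: "'k::field \<Rightarrow> 'k rop \<Rightarrow> 'k rop" is "\<lambda>c A S T. c * A S T"
  by (rule row_finite_scale)

lemma Rep_rop_rscale: "Rep_rop (rscale c a) = op_scale c (Rep_rop a)"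
  by (simp add: rscale.rep_eq op_scale_def)

global_interpretation rop: vector_space "rscale :: 'k::field \<Rightarrow> 'k rop \<Rightarrow> 'k rop"
  by unfold_locales (transfer; simp add: algebra_simps)+

global_interpretation op: vector_space "op_scale :: 'k::field \<Rightarrow> 'k op \<Rightarrow> 'k op"
  by unfold_locales (auto simp: op_scale_def fun_eq_iff algebra_simps)

global_interpretation Rep_rop: Vector_Spaces.linear rscale op_scale "Rep_rop :: 'k::field rop \<Rightarrow> 'k op"
  by unfold_locales (auto simp: plus_rop.rep_eq Rep_rop_rscale fun_eq_iff)

lemma rscale_mult_left: "rscale c a * b = rscale c (a * b)"
  by transfer (rule op_comp_scale_left)

lemma rscale_mult_right: "a * rscale c b = rscale c (a * b)"
  by transfer (rule op_comp_scale_right)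

lemma Rep_rop_sum: "Rep_rop (sum f F) S T = (\<Sum>i\<in>F. Rep_rop (f i) S T)"
  by (induction F rule: infinite_finite_induct) (auto simp: zero_rop.rep_eq plus_rop.rep_eq)

section \<open>Left multiplications, superderivations and their Clifford relations\<close>

lift_definition X :: "nat \<Rightarrow> 'k::field rop" is xop
  by (rule row_finite_single[where f = "\<lambda>S. insert _ S"]) (auto simp: xop_def split: if_splits)

lift_definition D :: "nat \<Rightarrow> 'k::field rop" is dop
  by (rule row_finite_single[where f = "\<lambda>S. S - {_}"]) (auto simp: dop_def split: if_splits)

text \<open>The sign that arises when the odd variable \<open>x_i\<close> moves past the factors of
  \<open>x_S\<close> with smaller index.\<close>

definition sgn_below :: "nat \<Rightarrow> nat set \<Rightarrow> 'k::field" where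
  "sgn_below i S = (-1) ^ card {j\<in>S. j < i}"

lemma sgn_below_insert:
  assumes "finite S" "k \<notin> S"
  shows "sgn_below i (insert k S) = (if k < i then - sgn_below i S else sgn_below i S)"
proof (cases "k < i")
  case True
  have "{j \<in> insert k S. j < i} = insert k {j \<in> S. j < i}" using True by auto
  then show ?thesis using assms True by (simp add: sgn_below_def)
next
  case False
  then have "{j \<in> insert k S. j < i} = {j \<in> S. j < i}" by auto
  then show ?thesis using False by (simp add: sgn_below_def)
qed

lemma sgn_below_remove:
  assumes "finite S" "k \<in> S"
  shows "sgn_below i (S - {k}) = (if k < i then - sgn_below i S else sgn_below i S)"
proof -
  have "insert k (S - {k}) = S" using assms by auto
  with sgn_below_insert[of "S - {k}" k i, where 'a = 'a] assms show ?thesis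
    by (simp split: if_splits)
qed

lemma sgn_below_sq [simp]: "sgn_below i S * sgn_below i S = 1"
  by (simp add: sgn_below_def flip: power_add)

text \<open>The right factor acts first: \<open>X i\<close> sends \<open>x_S\<close> to plus or
  minus one basis monomial, so only one row of \<open>a\<close> is read.\<close>

lemma mult_X_apply:
  "Rep_rop (a * X i) S U = (if finite S \<and> i \<notin> S then sgn_below i S * Rep_rop a (insert i S) U else 0)"
  unfolding times_rop.rep_eq X.rep_eq
  by (subst op_comp_single[where ?T0.0 = "insert i S"]) (auto simp: xop_def sgn_below_def)

lemma mult_D_apply:
  "Rep_rop (a * D i) S U = (if finite S \<and> i \<in> S then sgn_below i S * Rep_rop a (S - {i}) U else 0)"
  unfolding times_rop.rep_eq D.rep_eq
  by (subst op_comp_single[where ?T0.0 = "S - {i}"]) (auto simp: dop_def sgn_below_def)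

lemma X_apply: "Rep_rop (X i) S U = (if finite S \<and> i \<notin> S \<and> U = insert i S then sgn_below i S else 0)"
  by (simp add: X.rep_eq xop_def sgn_below_def)

lemma D_apply: "Rep_rop (D i) S U = (if finite S \<and> i \<in> S \<and> U = S - {i} then sgn_below i S else 0)"
  by (simp add: D.rep_eq dop_def sgn_below_def)

lemma Rep_rop_infinite: "infinite S \<Longrightarrow> Rep_rop a S T = 0"
  using Rep_rop[of a] by (auto simp: row_finite_def)

lemma rop_eqI: "(\<And>S T. finite S \<Longrightarrow> Rep_rop a S T = Rep_rop b S T) \<Longrightarrow> a = b"
  by (metis Rep_rop_infinite Rep_rop_inject ext)

lemma X_X: "X i * X j = - (X j * X i)"
  by (rule rop_eqI)
    (auto simp: mult_X_apply X_apply uminus_rop.rep_eq sgn_below_insert insert_commute)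

lemma X_sq: "X i * X i = (0 :: 'k::field rop)"
  by (rule rop_eqI) (auto simp: mult_X_apply X_apply zero_rop.rep_eq)

lemma D_D: "D i * D j = - (D j * D i)"
  by (rule rop_eqI)
    (auto simp: mult_D_apply D_apply uminus_rop.rep_eq sgn_below_remove)

lemma D_sq: "D i * D i = (0 :: 'k::field rop)"
  by (rule rop_eqI) (auto simp: mult_D_apply D_apply zero_rop.rep_eq)

lemma D_X: "i \<noteq> j \<Longrightarrow> D i * X j = - (X j * D i)"
  by (rule rop_eqI)
    (auto simp: mult_D_apply mult_X_apply D_apply X_apply uminus_rop.rep_eq sgn_below_remove sgn_below_insert)

lemma D_X_same: "D i * X i = 1 - X i * D i"
  by (rule rop_eqI)
    (auto simp: mult_D_apply mult_X_apply D_apply X_apply minus_rop.rep_eq one_rop.rep_eq op_id_def sgn_below_remove sgn_below_insert)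

section \<open>Pivot elements and their recursion\<close>

definition Xs :: "nat list \<Rightarrow> 'k::field rop" where
  "Xs js = prod_list (map X js)"

lemma Xs_simps [simp]: "Xs [] = 1" "Xs (j # js) = X j * Xs js" "Xs (js @ js') = Xs js * Xs js'"
  by (simp_all add: Xs_def)

lemma Rep_rop_Xs: "Rep_rop (Xs js) = xmon js"
  by (induction js) (simp_all add: xmon_def op_prod_def one_rop.rep_eq times_rop.rep_eq X.rep_eq)

definition pcoeff :: "nat \<Rightarrow> nat \<Rightarrow> 'k::field rop" where
  "pcoeff i k = Xs (concat (map (\<lambda>n. [i + 3*n, i + 3*n + 1]) [0..<k]))"

lemma pcoeff_0: "pcoeff i 0 = 1"
  by (simp add: pcoeff_def)

text \<open>Splitting off the factor with \<open>n = 0\<close> shifts the base index by 3; this is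
  the source of \<open>V_rec\<close>.\<close>

lemma pcoeff_Suc: "pcoeff i (Suc k) = X i * X (i + 1) * pcoeff (i + 3) k"
proof -
  have "[0..<Suc k] = 0 # map Suc [0..<k]" by (simp add: map_Suc_upt upt_conv_Cons)
  then show ?thesis
    by (simp add: pcoeff_def comp_def mult.assoc add_ac del: upt_Suc)
qed

lemma pivot_eq:
  "finite S \<Longrightarrow> pivot i S T = (\<Sum>k\<in>{k. i + 3*k \<in> S}. Rep_rop (pcoeff i k * D (i + 3*k)) S T)"
  by (simp add: pivot_def pivot_coeff_def times_rop.rep_eq D.rep_eq pcoeff_def Rep_rop_Xs)

lemma finite_pivot_index: "finite S \<Longrightarrow> finite {k. i + 3*k \<in> (S :: nat set)}"
  by (rule finite_vimageI[of S "\<lambda>k. i + 3*k", unfolded vimage_def]) (auto simp: inj_def)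

text \<open>A finite \<open>S\<close> contains only finitely many indices \<open>i + 3*k\<close>, so
  a row of the series is a finite sum of finite rows; the rows of infinite sets vanish.\<close>

lift_definition V :: "nat \<Rightarrow> 'k::field rop" is pivot
proof (rule row_finiteI)
  fix i :: nat and S
  show "finite {T. pivot i S T \<noteq> (0::'k)}"
  proof (cases "finite S")
    case True
    have "{T. pivot i S T \<noteq> (0::'k)} \<subseteq>
        (\<Union>k\<in>{k. i + 3*k \<in> S}. {T. Rep_rop (pcoeff i k * D (i + 3*k) :: 'k rop) S T \<noteq> 0})"
      using True by (auto simp: pivot_eq elim!: sum.not_neutral_contains_not_neutral)
    then show ?thesis
      by (rule finite_subset) (use Rep_rop finite_pivot_index[OF True] in \<open>auto simp: row_finite_def\<close>)
  next
    case False
    then show ?thesis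
      by (simp add: pivot_def op_comp_def dop_def)
  qed
next
  fix i :: nat and S T
  assume *: "pivot i S T \<noteq> (0::'k)"
  then have "finite S"
    by (rule contrapos_np) (simp add: pivot_def op_comp_def dop_def)
  moreover from this * obtain k where "Rep_rop (pcoeff i k * D (i + 3*k) :: 'k rop) S T \<noteq> 0"
    by (auto simp: pivot_eq elim!: sum.not_neutral_contains_not_neutral)
  ultimately show "finite S \<and> finite T"
    using Rep_rop[of "pcoeff i k * D (i + 3*k) :: 'k rop"] by (auto simp: row_finite_def)
qed

text \<open>For finite \<open>S\<close>: \<open>a\<close> annihilates \<open>x_S\<close>. Left
  multiples inherit this, so an infinite series can be compared with a finite part of it one row at
  a time.\<close>

definition kills :: "nat set \<Rightarrow> 'k::field rop \<Rightarrow> bool" where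
  "kills S a \<longleftrightarrow> (\<forall>T. Rep_rop a S T = 0)"

lemma kills_mult: "kills S b \<Longrightarrow> kills S (a * b)"
  by (simp add: kills_def times_rop.rep_eq op_comp_def)

lemma kills_add: "kills S a \<Longrightarrow> kills S b \<Longrightarrow> kills S (a + b)"
  by (simp add: kills_def plus_rop.rep_eq)

lemma kills_all: "(\<And>S. finite S \<Longrightarrow> kills S a) \<Longrightarrow> a = 0"
  by (rule rop_eqI) (simp add: kills_def zero_rop.rep_eq)

lemma V_kills: "S \<subseteq> {..<n} \<Longrightarrow> kills S (V n)"
  unfolding kills_def V.rep_eq pivot_def by (auto intro!: sum.neutral)

text \<open>The term \<open>k = 0\<close> of the series is \<open>D n\<close>. All later
  coefficients begin with \<open>X n * X (n + 1)\<close>, and what remains of them is the series of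
  \<open>V (n + 3)\<close>.\<close>

lemma V_rec: "V n = D n + X n * X (n + 1) * V (n + 3)"
proof (rule rop_eqI)
  fix S T :: "nat set"
  assume S: "finite S"
  define f where "f k = Rep_rop (pcoeff n k * D (n + 3*k) :: 'a rop) S T" for k
  define I where "I = {k. n + 3*k \<in> S}"
  define J where "J = {k. n + 3 + 3*k \<in> S}"
  have fin: "finite I" "finite J" unfolding I_def J_def by (rule finite_pivot_index[OF S])+
  have I: "I = (if n \<in> S then {0} else {}) \<union> Suc ` J"
  proof (rule set_eqI)
    show "k \<in> I \<longleftrightarrow> k \<in> (if n \<in> S then {0} else {}) \<union> Suc ` J" for k
      by (cases k) (auto simp: I_def J_def add.assoc)
  qed
  have "Rep_rop (V n) S T = sum f I"
    by (simp add: V.rep_eq pivot_eq[OF S] I_def f_def)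
  also have "\<dots> = sum f (if n \<in> S then {0} else {}) + sum f (Suc ` J)"
    unfolding I by (rule sum.union_disjoint) (use fin in auto)
  also have "sum f (if n \<in> S then {0} else {}) = Rep_rop (D n) S T"
    by (simp add: f_def pcoeff_0 D_apply)
  also have "sum f (Suc ` J) = (\<Sum>k\<in>J. f (Suc k))"
    by (subst sum.reindex) (auto simp: inj_def)
  also have "\<dots> = Rep_rop (X n * X (n + 1) * (\<Sum>k\<in>J. pcoeff (n + 3) k * D (n + 3 + 3*k)) :: 'a rop) S T"
    by (simp add: sum_distrib_left Rep_rop_sum f_def pcoeff_Suc mult.assoc add_ac)
  also have "\<dots> = Rep_rop (X n * X (n + 1) * V (n + 3) :: 'a rop) S T"
  proof -
    \<comment> \<open>The finite sum agrees with \<open>V (n + 3)\<close> on row \<open>S\<close>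
      only; left multiplication preserves this agreement.\<close>
    have "kills S (V (n + 3) - (\<Sum>k\<in>J. pcoeff (n + 3) k * D (n + 3 + 3*k)) :: 'a rop)"
      by (auto simp: kills_def minus_rop.rep_eq V.rep_eq pivot_eq[OF S] Rep_rop_sum J_def)
    then have "kills S (X n * X (n + 1) * (V (n + 3) - (\<Sum>k\<in>J. pcoeff (n + 3) k * D (n + 3 + 3*k))) :: 'a rop)"
      by (rule kills_mult)
    then show ?thesis by (simp add: kills_def right_diff_distrib minus_rop.rep_eq)
  qed
  finally show "Rep_rop (V n) S T = Rep_rop (D n + X n * X (n + 1) * V (n + 3) :: 'a rop) S T"
    by (simp add: plus_rop.rep_eq)
qed

text \<open>Every finite row is killed by all but finitely many pivots, so identities between pivots
  follow from the recursion by descending induction on the index.\<close>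

lemma V_anticommute_aux:
  assumes C: "\<And>i. n \<le> i \<Longrightarrow> C * X i = - (X i * C)" "\<And>i. n \<le> i \<Longrightarrow> D i * C = - (C * D i)"
    and kill: "\<And>i. n \<le> i \<Longrightarrow> S \<subseteq> {..<i} \<Longrightarrow> kills S (V i * C)"
    and S: "finite S"
  shows "kills S (V n * C + C * V n)"
proof -
  obtain M where M: "S \<subseteq> {..<M}" using S finite_nat_set_iff_bounded by auto
  have "kills S (V i * C + C * V i)" if "n \<le> i" for i
    using that
  proof (induction "M - i" arbitrary: i rule: less_induct)
    case less
    show ?case
    proof (cases "M \<le> i")
      case True
      then have "S \<subseteq> {..<i}" using M by auto
      with less.prems show ?thesis by (intro kills_add kills_mult kill V_kills)
    next
      case False
      \<comment> \<open>\<open>C\<close> anticommutes with \<open>D i\<close> and passes the even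
        product \<open>X i * X (i + 1)\<close> without a sign, so its anticommutator with the pivot
        obeys the recursion.\<close>
      have "V i * C + C * V i = X i * X (i + 1) * (V (i + 3) * C + C * V (i + 3))"
      proof -
        have c: "C * X i = - (X i * C)" "C * X (i + 1) = - (X (i + 1) * C)" "D i * C = - (C * D i)"
          using C less.prems by auto
        have "C * (X i * X (i + 1) * V (i + 3)) = (C * X i) * X (i + 1) * V (i + 3)"
          by (simp only: mult.assoc)
        also have "\<dots> = - X i * (C * X (i + 1)) * V (i + 3)"
          unfolding c(1) by (simp add: mult.assoc)
        also have "\<dots> = X i * X (i + 1) * (C * V (i + 3))"
          unfolding c(2) by (simp add: mult.assoc)
        finally have XX: "C * (X i * X (i + 1) * V (i + 3)) = X i * X (i + 1) * (C * V (i + 3))" .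
        have "V i * C + C * V i = D i * C + C * D i
            + (X i * X (i + 1) * V (i + 3) * C + C * (X i * X (i + 1) * V (i + 3)))"
          by (subst (1 2) V_rec[of i]) (simp only: distrib_left distrib_right add_ac)
        then show ?thesis unfolding XX c(3) by (simp add: distrib_left mult.assoc)
      qed
      moreover have "kills S (V (i + 3) * C + C * V (i + 3))"
        using less False by auto
      ultimately show ?thesis by (simp add: kills_mult)
    qed
  qed
  then show ?thesis by simp
qed

lemma V_X_less: assumes "j < n" shows "V n * X j = - (X j * V n)"
proof -
  have "V n * X j + X j * V n = 0"
  proof (rule kills_all, rule V_anticommute_aux)
    show "kills S (V i * X j)" if "n \<le> i" "S \<subseteq> {..<i}" for i S
      using V_kills[of "insert j S" i] that assms
      by (auto simp: kills_def mult_X_apply)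
  qed (use assms in \<open>auto intro: X_X D_X\<close>)
  then show ?thesis by (simp add: eq_neg_iff_add_eq_0)
qed

lemma V_D_less: assumes "j < n" shows "V n * D j = - (D j * V n)"
proof -
  have "V n * D j + D j * V n = 0"
  proof (rule kills_all, rule V_anticommute_aux)
    show "kills S (V i * D j)" if "n \<le> i" "S \<subseteq> {..<i}" for i S
    proof -
      have "kills (S - {j}) (V i)" using that by (intro V_kills) auto
      then show ?thesis by (auto simp: kills_def mult_D_apply)
    qed
    show "D j * X i = - (X i * D j)" if "n \<le> i" for i
      using assms that by (intro D_X) auto
  qed (use assms in \<open>auto intro: D_D\<close>)
  then show ?thesis by (simp add: eq_neg_iff_add_eq_0)
qed

subsection \<open>Signed monomials and supercommutators\<close>

text \<open>The Boolean exponent of -1 turns parity bookkeeping into propositional logic.\<close>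

definition sg :: "bool \<Rightarrow> 'a::ring_1 \<Rightarrow> 'a" where
  "sg p a = (if p then - a else a)"

lemma sg_simps [simp]:
  "sg p a * b = sg p (a * b)" "a * sg p b = sg p (a * b)" "sg p (sg q a) = sg (p \<noteq> q) a"
  "sg True a = - a" "sg False a = a" "sg p 0 = 0" "- sg p a = sg (\<not> p) a" "sg p (- a) = sg (\<not> p) a"
  by (simp_all add: sg_def)

definition sbracket :: "bool \<Rightarrow> bool \<Rightarrow> 'a::ring_1 \<Rightarrow> 'a \<Rightarrow> 'a" where
  "sbracket p q a b = a * b - sg (p \<and> q) (b * a)"

lemma sbracket_flip: "sbracket p q a b = sg (\<not> (p \<and> q)) (sbracket q p b a)"
  by (auto simp: sbracket_def sg_def)

lemma Rep_rop_sbracket: "Rep_rop (sbracket p q a b) = sbr p q (Rep_rop a) (Rep_rop b)"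
  by (auto simp: sbracket_def sbr_def sg_def fun_eq_iff minus_rop.rep_eq uminus_rop.rep_eq times_rop.rep_eq plus_rop.rep_eq)

lemma sbracket_bilinear:
  "sbracket p q (a + a') b = sbracket p q a b + sbracket p q a' b"
  "sbracket p q a (b + b') = sbracket p q a b + sbracket p q a b'"
  by (auto simp: sbracket_def sg_def algebra_simps)

lemma sbracket_scale:
  "sbracket p q (rscale c a) b = rscale c (sbracket p q a b)"
  "sbracket p q a (rscale c b) = rscale c (sbracket p q a b)"
  by (auto simp: sbracket_def sg_def rscale_mult_left rscale_mult_right rop.scale_right_diff_distrib
      rop.scale_right_distrib)

text \<open>A product of the \<open>x_i\<close> with \<open>i \<in> M\<close>, in any order and with
  either sign. Signs do not affect spans, so leaving them free avoids sorting the factors.\<close>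

inductive mon :: "nat set \<Rightarrow> 'k::field rop \<Rightarrow> bool" where
  mon_one: "mon {} 1"
| mon_X: "mon M a \<Longrightarrow> i \<notin> M \<Longrightarrow> mon (insert i M) (X i * a)"
| mon_neg: "mon M a \<Longrightarrow> mon M (- a)"

lemma mon_finite: "mon M a \<Longrightarrow> finite M"
  by (induction rule: mon.induct) auto

lemma mon_single: "mon {i} (X i)"
  using mon_X[OF mon_one, of i] by simp

lemma mon_Xs: "distinct js \<Longrightarrow> mon (set js) (Xs js)"
  by (induction js) (auto intro: mon_one mon_X)

text \<open>Each factor of \<open>a\<close> contributes the same sign when it passes
  \<open>c\<close>, so only the parity of \<open>card M\<close> matters.\<close>

lemma mon_scomm:
  assumes "mon M a" and "\<And>i. i \<in> M \<Longrightarrow> X i * c = sg p (c * X i)"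
  shows "a * c = sg (odd (card M) \<and> p) (c * a)"
  using assms
proof (induction rule: mon.induct)
  case (mon_X M a i)
  have "X i * a * c = X i * sg (odd (card M) \<and> p) (c * a)"
    using mon_X by (simp add: mult.assoc)
  also have "\<dots> = sg (odd (card M) \<and> p) (X i * c * a)" by (simp add: mult.assoc)
  also have "\<dots> = sg ((odd (card M) \<and> p) \<noteq> p) (c * (X i * a))"
    using mon_X.prems[of i] by (simp add: mult.assoc)
  also have "((odd (card M) \<and> p) \<noteq> p) = (odd (card (insert i M)) \<and> p)"
    using mon_finite[OF mon_X.hyps(1)] mon_X.hyps(2) by auto
  finally show ?case .
qed (auto simp: sg_def)

lemma mon_X_comm: "mon M a \<Longrightarrow> a * X j = sg (odd (card M)) (X j * a)"
  using mon_scomm[of M a "X j" True] X_X by auto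

lemma mon_V_comm: "mon M a \<Longrightarrow> M \<subseteq> {..<n} \<Longrightarrow> a * V n = sg (odd (card M)) (V n * a)"
  using mon_scomm[of M a "V n" True] by (simp add: subset_eq V_X_less)

lemma mon_D_comm: "mon M a \<Longrightarrow> j \<notin> M \<Longrightarrow> a * D j = sg (odd (card M)) (D j * a)"
  using mon_scomm[of M a "D j" True] D_X[of j] by (metis minus_minus sg_simps(4))

lemma mon_mon_comm:
  assumes "mon M a" "mon N b"
  shows "a * b = sg (odd (card M) \<and> odd (card N)) (b * a)"
  using assms(1)
proof (rule mon_scomm)
  show "X i * b = sg (odd (card N)) (b * X i)" for i
    by (simp add: mon_X_comm[OF assms(2)])
qed

lemma mon_pull:
  assumes "mon M a" "i \<in> M"
  shows "\<exists>b. mon (M - {i}) b \<and> a = X i * b"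
  using assms
proof (induction rule: mon.induct)
  case (mon_X M a j)
  show ?case
  proof (cases "i = j")
    case True
    with mon_X.hyps show ?thesis by (intro exI[of _ a]) auto
  next
    case False
    with mon_X obtain b where b: "mon (M - {i}) b" "a = X i * b" by auto
    have "mon (insert j (M - {i})) (X j * b)" using b(1) mon_X.hyps(2) by (intro mon.mon_X) auto
    then have "mon (insert j M - {i}) (- (X j * b))"
      using False by (auto simp: insert_Diff_if intro: mon_neg)
    moreover have "X j * a = X i * (- (X j * b))"
      by (simp add: b(2) X_X[of j i] flip: mult.assoc)
    ultimately show ?thesis by blast
  qed
next
  case (mon_neg M a)
  then obtain b where "mon (M - {i}) b" "a = X i * b" by auto
  then show ?case by (intro exI[of _ "- b"]) (auto intro: mon.mon_neg)
qed auto

lemma mon_empty: "mon M a \<Longrightarrow> M = {} \<Longrightarrow> a = 1 \<or> a = - 1"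
  by (induction rule: mon.induct) auto

lemma mon_unique: "mon M a \<Longrightarrow> mon M b \<Longrightarrow> \<exists>p. b = sg p a"
proof (induction arbitrary: b rule: mon.induct)
  case mon_one
  then show ?case using mon_empty[of "{}" b] by (auto simp: sg_def)
next
  case (mon_X M a i)
  from mon_pull[OF mon_X.prems, of i] mon_X.hyps(2)
  obtain c where "mon M c" "b = X i * c" by auto
  with mon_X.IH show ?case by fastforce
next
  case (mon_neg M a)
  then obtain p where "b = sg p a" by blast
  then have "b = sg (\<not> p) (- a)" by simp
  then show ?case ..
qed

lemma mon_mult: "mon M a \<Longrightarrow> mon N b \<Longrightarrow> M \<inter> N = {} \<Longrightarrow> mon (M \<union> N) (a * b)"
  by (induction rule: mon.induct) (auto simp: mult.assoc intro: mon_X mon_neg)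

lemma mon_mult_zero:
  assumes "mon M a" "mon N b" "M \<inter> N \<noteq> {}"
  shows "a * b = 0"
proof -
  obtain i where i: "i \<in> M" "i \<in> N" using assms(3) by auto
  obtain a' b' where "a = X i * a'" "b = X i * b'" using mon_pull assms i by metis
  then have "a * b = a * X i * b'" "X i * a = X i * X i * a'" by (simp_all add: mult.assoc)
  then show ?thesis by (simp add: mon_X_comm[OF assms(1), of i] X_sq)
qed

section \<open>Relations between pivots\<close>

lemma X_V_same: "X n * V n = X n * D n"
  \<comment> \<open>Every term of \<open>V n\<close> after the first begins with \<open>X n\<close>,
    which squares to zero.\<close>
  by (subst V_rec) (simp add: distrib_left X_sq flip: mult.assoc)

lemma V_X_same: "V n * X n = 1 - X n * V n"
proof -
  have "V n * X n = D n * X n + X n * X (n + 1) * (V (n + 3) * X n)"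
    by (subst V_rec) (simp add: distrib_right mult.assoc)
  also have "X n * X (n + 1) * (V (n + 3) * X n) = - (X n * (X (n + 1) * X n) * V (n + 3))"
    by (simp add: V_X_less mult.assoc)
  also have "X n * (X (n + 1) * X n) = - (X n * X n * X (n + 1))"
    by (simp add: X_X[of "Suc n" n] mult.assoc)
  also have "\<dots> = 0" by (simp add: X_sq)
  finally show ?thesis by (simp add: D_X_same X_V_same)
qed

text \<open>Of the expanded square, \<open>V n * D n\<close> cancels against the part of the other
  summand in which \<open>D n\<close> passes \<open>X (n + 1)\<close>; the constant 1 in
  \<open>V_X_same\<close> leaves the result.\<close>

lemma V_sq: "V n * V n = X (n + 1) * V (n + 3)"
proof -
  have "V n * V n = V n * D n + V n * X n * (X (n + 1) * V (n + 3))"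
    by (subst (2) V_rec) (simp add: distrib_left mult.assoc)
  also have "V n * D n = X n * (X (n + 1) * (V (n + 3) * D n))"
    by (subst V_rec) (simp add: distrib_right D_sq mult.assoc)
  also have "V n * X n * (X (n + 1) * V (n + 3))
      = X (n + 1) * V (n + 3) - X n * (D n * X (n + 1)) * V (n + 3)"
    by (simp add: V_X_same X_V_same left_diff_distrib mult.assoc)
  also have "X n * (D n * X (n + 1)) * V (n + 3) = X n * (X (n + 1) * (V (n + 3) * D n))"
    by (simp add: D_X V_D_less mult.assoc)
  finally show ?thesis by simp
qed

definition anticomm :: "nat \<Rightarrow> nat \<Rightarrow> 'k::field rop" where
  "anticomm n m = V n * V m + V m * V n"

lemma anticomm_commute: "anticomm n m = anticomm m n"
  by (simp add: anticomm_def add.commute)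

lemma anticomm_same: "anticomm n n = 2 * (X (n + 1) * V (n + 3))"
  by (simp add: anticomm_def V_sq mult_2)

text \<open>The recursion carried through a supercommutator: passing \<open>C\<close> costs the same
  sign for \<open>X n\<close> and for \<open>X (n + 1)\<close>, hence none for their
  product.\<close>

lemma sbracket_V_step:
  assumes "X n * C = sg p (C * X n)" "X (n + 1) * C = sg p (C * X (n + 1))"
  shows "sbracket True p (V n) C = sbracket True p (D n) C + X n * X (n + 1) * sbracket True p (V (n + 3)) C"
proof -
  have "X n * X (n + 1) * C = C * (X n * X (n + 1))"
    using assms by (simp add: mult.assoc) (simp flip: mult.assoc add: assms)
  then have XX: "X n * X (n + 1) * (C * V (n + 3)) = C * (X n * X (n + 1) * V (n + 3))"
    by (simp flip: mult.assoc)
  have "sbracket True p (V n) C = sbracket True p (D n) C + X n * X (n + 1) * V (n + 3) * C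
      - sg p (C * (X n * X (n + 1) * V (n + 3)))"
    by (subst V_rec) (simp add: sbracket_def distrib_left distrib_right sg_def)
  also have "\<dots> = sbracket True p (D n) C + X n * X (n + 1) * sbracket True p (V (n + 3)) C"
    unfolding XX[symmetric] by (simp add: sbracket_def right_diff_distrib mult.assoc)
  finally show ?thesis .
qed

text \<open>\<open>X n\<close> reduces \<open>V n\<close> to \<open>D n\<close>, and both
  \<open>X n\<close> and \<open>D n\<close> anticommute with \<open>V m\<close> for
  \<open>m > n\<close>.\<close>

lemma X_anticomm: assumes "n < m" shows "X n * anticomm n m = 0"
proof -
  have "X n * anticomm n m = X n * V n * V m - V m * X n * V n"
    by (simp add: anticomm_def distrib_left V_X_less[OF assms] mult.assoc)
  also have "\<dots> = X n * (D n * V m) - V m * X n * D n"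
    by (simp add: X_V_same mult.assoc)
  also have "\<dots> = 0"
    by (simp add: V_D_less[OF assms] V_X_less[OF assms] mult.assoc)
  finally show ?thesis .
qed

lemma anticomm_rec: assumes "n + 1 < m" shows "anticomm n m = X n * X (n + 1) * anticomm (n + 3) m"
  using sbracket_V_step[of n "V m" True] assms by (simp add: sbracket_def anticomm_def V_X_less V_D_less)

text \<open>\<open>anticomm_rec\<close> does not reach this case, as \<open>V (n + 1)\<close> and
  \<open>X (n + 1)\<close> do not anticommute. The constant 1 of \<open>V_X_same\<close> at
  \<open>n + 1\<close> produces the result; the rest vanishes by \<open>X_anticomm\<close>.\<close>

lemma anticomm_1: "anticomm n (n + 1) = - (X n * V (n + 3))"
proof -
  have 1: "V (n + 1) * X n = - (X n * V (n + 1))" "V (n + 1) * D n = - (D n * V (n + 1))"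
    by (simp_all add: V_X_less V_D_less)
  have "anticomm n (n + 1) = X n * (X (n + 1) * V (n + 3) * V (n + 1)) + V (n + 1) * X n * X (n + 1) * V (n + 3)"
    unfolding anticomm_def by (simp add: V_rec[of n] distrib_left distrib_right mult.assoc 1(2)[simplified])
  also have "\<dots> = X n * (X (n + 1) * V (n + 3) * V (n + 1) - V (n + 1) * X (n + 1) * V (n + 3))"
    unfolding 1(1) by (simp add: right_diff_distrib mult.assoc)
  also have "X (n + 1) * V (n + 3) * V (n + 1) - V (n + 1) * X (n + 1) * V (n + 3)
      = X (n + 1) * anticomm (n + 1) (n + 3) - V (n + 3)"
    unfolding V_X_same anticomm_def by (simp add: algebra_simps)
  also have "\<dots> = - V (n + 3)" by (simp add: X_anticomm)
  finally show ?thesis by simp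
qed

text \<open>One recursion step leads to the adjacent pivots \<open>n + 3\<close> and
  \<open>n + 2\<close>; likewise \<open>anticomm_3\<close> leads to the square of
  \<open>V (n + 3)\<close>.\<close>

lemma anticomm_2: "(anticomm n (n + 2) :: 'k::field rop) = - (X n * (X (n + 1) * (X (n + 2) * V (n + 5))))"
proof -
  have "(anticomm (n + 3) (n + 2) :: 'k rop) = - (X (n + 2) * V (n + 5))"
    by (subst anticomm_commute) (use anticomm_1[of "n + 2", where 'a = 'k] in \<open>simp add: eval_nat_numeral\<close>)
  then show ?thesis by (subst anticomm_rec) (simp_all add: mult.assoc)
qed

lemma anticomm_3: "(anticomm n (n + 3) :: 'k::field rop) = 2 * (X n * (X (n + 1) * (X (n + 4) * V (n + 6))))"
proof -
  have "(anticomm (n + 3) (n + 3) :: 'k rop) = 2 * (X (n + 4) * V (n + 6))"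
    using anticomm_same[of "n + 3", where 'a = 'k] by (simp add: numeral_eq_Suc)
  then show ?thesis by (simp add: anticomm_rec[of n "n + 3"] mult_2 distrib_left mult.assoc)
qed

section \<open>Supercommutators of pivots with monomial coefficients\<close>

lemma sbracket_mon_left:
  assumes "mon J a" "J \<subseteq> {..<m}" "mon K b"
  shows "sbracket (even (card J)) (even (card K)) (a * V n) (b * V m)
       = a * sbracket True (even (card K)) (V n) (b * V m)"
proof -
  \<comment> \<open>As \<open>J\<close> lies below \<open>m\<close>, \<open>a\<close> supercommutes
    with \<open>b * V m\<close>. A pivot is odd, so \<open>b * V m\<close> is odd exactly when
    \<open>card K\<close> is even.\<close>
  have "a * (b * V m) = sg (odd (card J) \<and> even (card K)) (b * V m * a)"
  proof -
    have "a * (b * V m) = sg (odd (card J) \<and> odd (card K)) (b * (a * V m))"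
      using mon_mon_comm[OF assms(1,3)] by (simp flip: mult.assoc)
    then show ?thesis
      by (simp add: mon_V_comm[OF assms(1,2)] mult.assoc) (auto simp: sg_def)
  qed
  then have "b * V m * (a * V n) = sg (odd (card J) \<and> even (card K)) (a * (b * V m * V n))"
    by (simp flip: mult.assoc)
  then show ?thesis
    unfolding sbracket_def by (auto simp: right_diff_distrib mult.assoc sg_def distrib_left)
qed

lemma sbracket_V_below:
  assumes "mon K b" "K \<subseteq> {..<n}"
  shows "sbracket True (even (card K)) (V n) (b * V m) = sg (odd (card K)) (b * anticomm n m)"
proof -
  have "V n * (b * V m) = sg (odd (card K)) (b * (V n * V m))"
    using mon_V_comm[OF assms] by (simp flip: mult.assoc)
  then show ?thesis by (auto simp: sbracket_def sg_def anticomm_def distrib_left mult.assoc)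
qed

lemma sbracket_below:
  assumes "mon J a" "mon K b" "J \<subseteq> {..<m}" "K \<subseteq> {..<n}"
  shows "sbracket (even (card J)) (even (card K)) (a * V n) (b * V m) = sg (odd (card K)) (a * b * anticomm n m)"
  using assms by (simp add: sbracket_mon_left sbracket_V_below mult.assoc)

text \<open>\<open>D n\<close> differentiates the factor \<open>x_n\<close> out of \<open>b\<close>,
  and it anticommutes with \<open>V m\<close> because \<open>n < m\<close>.\<close>

lemma sbracket_D:
  assumes "mon K b" "n < m" "n \<in> K"
  shows "\<exists>c. mon (K - {n}) c \<and> b = X n * c \<and> sbracket True (even (card K)) (D n) (b * V m) = c * V m"
proof -
  obtain c where c: "mon (K - {n}) c" "b = X n * c" using mon_pull assms by blast
  have K: "even (card K) \<longleftrightarrow> odd (card (K - {n}))"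
    using assms(3) mon_finite[OF assms(1)] by (metis card_Suc_Diff1 even_Suc)
  have "D n * (b * V m) = c * V m - X n * (D n * c) * V m"
    unfolding c(2) by (simp add: D_X_same left_diff_distrib flip: mult.assoc)
  moreover have "b * V m * D n = - (X n * (c * D n)) * V m"
    unfolding c(2) by (simp add: V_D_less[OF assms(2)] mult.assoc)
  ultimately have "sbracket True (even (card K)) (D n) (b * V m) = c * V m"
    using mon_D_comm[OF c(1), of n] by (simp add: sbracket_def K mult.assoc sg_def)
  with c show ?thesis by blast
qed

lemma sbracket_D_zero:
  assumes "mon K b" "n < m" "n \<notin> K"
  shows "sbracket True (even (card K)) (D n) (b * V m) = 0"
proof -
  have "b * V m * D n = sg (even (card K)) (D n * (b * V m))"
    by (simp add: V_D_less[OF assms(2)] mult.assoc) (simp add: mon_D_comm[OF assms(1,3)] flip: mult.assoc)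
  then show ?thesis by (simp add: sbracket_def)
qed

lemma mon_V_X_comm:
  assumes "mon K b" "n < m"
  shows "X n * (b * V m) = sg (even (card K)) (b * V m * X n)"
proof -
  have "b * V m * X n = sg (even (card K)) (X n * (b * V m))"
    by (simp add: V_X_less[OF assms(2)] mult.assoc) (simp add: mon_X_comm[OF assms(1)] flip: mult.assoc)
  then show ?thesis by simp
qed

text \<open>All of \<open>V n\<close> acts like its first term \<open>D n\<close>: the remainder
  \<open>E\<close> contains \<open>X n\<close>, as does \<open>b\<close>, so \<open>E\<close> and
  \<open>b * V m\<close> annihilate each other in both orders.\<close>

lemma sbracket_V_hit:
  fixes b :: "'k::field rop"
  assumes b: "mon K b" and n: "n < m" "n \<in> K"
  shows "\<exists>c. mon (K - {n}) c \<and> sbracket True (even (card K)) (V n) (b * V m) = c * V m"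
proof -
  obtain c where c: "mon (K - {n}) c" "b = X n * c"
    and D: "sbracket True (even (card K)) (D n) (b * V m) = c * V m"
    using sbracket_D[OF b n] by blast
  define C where "C = b * V m"
  define E :: "'k rop" where "E = X n * X (n + 1) * V (n + 3)"
  have XC: "X n * C = 0" unfolding C_def c(2) by (simp add: X_sq flip: mult.assoc)
  have CX: "C * X n = 0"
    using mon_V_X_comm[OF b n(1)] XC by (auto simp: C_def sg_def split: if_splits)
  have "E = X (n + 1) * V (n + 3) * X n"
    by (simp add: E_def V_X_less mult.assoc) (simp add: X_X[of n "Suc n"] flip: mult.assoc)
  then have "E * C = 0" by (simp add: mult.assoc XC)
  moreover have "C * E = 0" using CX by (simp add: E_def flip: mult.assoc)
  ultimately have "sbracket True (even (card K)) (V n) C = sbracket True (even (card K)) (D n) C"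
    unfolding sbracket_def V_rec[of n] E_def[symmetric] by (simp add: distrib_left distrib_right)
  with c(1) D show ?thesis unfolding C_def by metis
qed

subsection \<open>Standard monomials are closed under supercommutators\<close>

text \<open>Both types at once; the second disjunct also admits the shapes \<open>x_0 v_2\<close> and \<open>x_0 x_3 v_5\<close>,
  which are ruled out by their negative weight.\<close>

definition standard :: "nat \<Rightarrow> nat set \<Rightarrow> bool" where
  "standard k M \<longleftrightarrow> (\<forall>j\<in>M. j + 3 \<le> k) \<or> (\<forall>j\<in>M. j + 5 \<le> k \<or> j + 2 = k)"

text \<open>The recursion makes both summands of \<open>V_rec\<close> homogeneous of weight
  \<open>alpha n\<close>. With initial values 1, 0, 0 the weight of a word counts the occurrences of
  \<open>V 0\<close>, hence is nonnegative.\<close>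

fun alpha :: "nat \<Rightarrow> int" where
  "alpha 0 = 1"
| "alpha (Suc 0) = 0"
| "alpha (Suc (Suc 0)) = 0"
| "alpha (Suc (Suc (Suc n))) = 2 * alpha n + alpha (Suc n)"

lemma alpha_rec: "alpha (n + 3) = 2 * alpha n + alpha (n + 1)"
  by (simp add: numeral_3_eq_3)

text \<open>First coordinate of the multidegree counting the generators \<open>v_0, v_1, v_2\<close>.\<close>

definition wt :: "nat \<Rightarrow> nat set \<Rightarrow> int" where
  "wt k M = alpha k - sum alpha M"

text \<open>The room left below \<open>n\<close> is what the induction step for \<open>[v_n, x_K v_m]\<close> and the final
  multiplication by \<open>x_J\<close> with \<open>J \<subseteq> {0..n-2}\<close> use up.\<close>

definition cone :: "nat \<Rightarrow> int \<Rightarrow> bool \<Rightarrow> 'k::field rop set" where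
  "cone n w p = {a * V k |k M a. mon M a \<and> (\<forall>L. L \<subseteq> {j. j + 2 \<le> n} \<longrightarrow> standard k (M \<union> L))
     \<and> wt k M = w \<and> even (card M) = p}"

lemma coneI:
  assumes "mon M a" "\<And>L. L \<subseteq> {j. j + 2 \<le> n} \<Longrightarrow> standard k (M \<union> L)" "wt k M = w" "even (card M) = p"
  shows "a * V k \<in> cone n w p"
  using assms unfolding cone_def by blast

lemma span_mult_left:
  assumes "\<And>x. x \<in> A \<Longrightarrow> c * x \<in> rop.span B" "y \<in> rop.span A"
  shows "c * y \<in> rop.span B"
  using assms(2)
proof (induction rule: rop.span_induct)
  case base
  then show ?case
    by (auto simp: rop.subspace_def distrib_left rscale_mult_right
        intro: rop.span_zero rop.span_add rop.span_scale)
qed (rule assms(1))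

lemma sbracket_span:
  assumes "\<And>a b. a \<in> A \<Longrightarrow> b \<in> B \<Longrightarrow> sbracket p q a b \<in> rop.span C"
    and "x \<in> rop.span A" "y \<in> rop.span B"
  shows "sbracket p q x y \<in> rop.span C"
proof -
  have zero: "sbracket p q 0 b = 0" "sbracket p q b 0 = 0" for b :: "'a rop" by (simp_all add: sbracket_def)
  have 1: "sbracket p q a y \<in> rop.span C" if a: "a \<in> A" for a
    using assms(3)
  proof (induction rule: rop.span_induct)
    case base
    then show ?case
      by (auto simp: rop.subspace_def sbracket_bilinear sbracket_scale zero
          intro: rop.span_zero rop.span_add rop.span_scale)
  qed (rule assms(1)[OF a])
  show ?thesis
    using assms(2)
  proof (induction rule: rop.span_induct)
    case base
    then show ?case
      by (auto simp: rop.subspace_def sbracket_bilinear sbracket_scale zero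
          intro: rop.span_zero rop.span_add rop.span_scale)
  qed (rule 1)
qed

lemma span_sg: "x \<in> rop.span A \<Longrightarrow> sg p x \<in> rop.span A"
  by (simp add: sg_def rop.span_neg)

text \<open>The factors \<open>x_N\<close> are drawn from the room reserved in the cone at
  \<open>n'\<close>; since \<open>n \<le> n'\<close>, the room at \<open>n\<close> can still be
  filled afterwards. If \<open>N\<close> meets \<open>M\<close>, the product is zero.\<close>

lemma cone_mult:
  assumes c: "mon N c" and N: "N \<subseteq> {j. j + 2 \<le> n'}" "n \<le> n'"
    and y: "y \<in> rop.span (cone n' w p)"
  shows "c * y \<in> rop.span (cone n (w - sum alpha N) (p \<noteq> odd (card N)))"
  using _ y
proof (rule span_mult_left)
  fix x :: "'a rop"
  assume "x \<in> cone n' w p"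
  then obtain k M a where x: "x = a * V k" and a: "mon M a" and
    M: "\<And>L. L \<subseteq> {j. j + 2 \<le> n'} \<Longrightarrow> standard k (M \<union> L)" "wt k M = w" "even (card M) = p"
    unfolding cone_def by blast
  show "c * x \<in> rop.span (cone n (w - sum alpha N) (p \<noteq> odd (card N)))"
  proof (cases "N \<inter> M = {}")
    case True
    have fin: "finite N" "finite M" using mon_finite a c by auto
    have "c * a * V k \<in> cone n (w - sum alpha N) (p \<noteq> odd (card N))"
    proof (rule coneI)
      show "mon (N \<union> M) (c * a)" by (rule mon_mult[OF c a True])
      show "standard k (N \<union> M \<union> L)" if "L \<subseteq> {j. j + 2 \<le> n}" for L
      proof -
        have "standard k (M \<union> (N \<union> L))" using that N by (intro M(1)) force
        then show ?thesis by (simp add: Un_ac)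
      qed
      show "wt k (N \<union> M) = w - sum alpha N"
        using M(2) True fin by (simp add: wt_def sum.union_disjoint)
      show "even (card (N \<union> M)) = (p \<noteq> odd (card N))"
        using M(3) True fin by (auto simp: card_Un_disjoint)
    qed
    then show ?thesis unfolding x by (simp add: rop.span_base mult.assoc)
  next
    case False
    then show ?thesis unfolding x using mon_mult_zero[OF c a]
      by (simp add: rop.span_zero flip: mult.assoc)
  qed
qed

text \<open>If the removed index is \<open>m - 2\<close>, then \<open>L\<close> stays at or below
  \<open>m - 4\<close> and the result is of the first type. Otherwise \<open>n\<close> is small
  enough for \<open>L\<close> to fit into the original type.\<close>

lemma standard_remove_Un:
  assumes "standard m K" "n \<in> K" "L \<subseteq> {j. j + 2 \<le> n}"
  shows "standard m (K - {n} \<union> L)"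
proof -
  have L: "j + 2 \<le> n" if "j \<in> L" for j using that assms(3) by auto
  from assms(1) consider "\<forall>j\<in>K. j + 3 \<le> m" | "\<forall>j\<in>K. j + 5 \<le> m \<or> j + 2 = m"
    unfolding standard_def by blast
  then show ?thesis
  proof cases
    case 1
    then have "j + 3 \<le> m" if "j \<in> K - {n} \<union> L" for j using that assms(2) L[of j] by force
    then show ?thesis unfolding standard_def by blast
  next
    case 2
    show ?thesis
    proof (cases "n + 2 = m")
      case True
      have "j + 3 \<le> m" if "j \<in> K - {n} \<union> L" for j
        using that 2 L[of j] True by force
      then show ?thesis unfolding standard_def by blast
    next
      case False
      then have "n + 5 \<le> m" using 2 assms(2) by blast
      then have "j + 5 \<le> m \<or> j + 2 = m" if "j \<in> K - {n} \<union> L" for j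
        using that 2 L[of j] by force
      then show ?thesis unfolding standard_def by blast
    qed
  qed
qed

text \<open>Descending induction on \<open>n\<close> in steps of 3. For \<open>n + 2 \<le> m\<close>
  the recursion gives a term with \<open>x_n\<close> stripped from \<open>b\<close> and the
  supercommutator at \<open>n + 3\<close> multiplied by \<open>X n * X (n + 1)\<close>; the other
  cases are known values.\<close>

lemma V_bracket_cone:
  fixes b :: "'k::field rop"
  assumes b: "mon K b" and K: "standard m K" and "n \<le> m + 1"
  shows "sbracket True (even (card K)) (V n) (b * V m) \<in> rop.span (cone n (alpha n + wt m K) (odd (card K)))"
  using assms(3)
proof (induction "m + 1 - n" arbitrary: n rule: less_induct)
  case less
  have Km: "j + 2 \<le> m" if "j \<in> K" for j using K that by (force simp: standard_def)
  have fin: "finite K" using mon_finite[OF b] .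
  \<comment> \<open>The three terminal cases all yield terms of this shape: \<open>b\<close> gains
    one new factor.\<close>
  have base: "b * X i * V k \<in> rop.span (cone n (alpha n + wt m K) (odd (card K)))"
    if "i \<notin> K" "\<And>L. L \<subseteq> {j. j + 2 \<le> n} \<Longrightarrow> standard k (insert i K \<union> L)" "alpha k - alpha i = alpha n + alpha m" for i k
  proof (rule rop.span_base, rule coneI)
    show "mon (insert i K) (b * X i)" using mon_mult[OF b mon_single, of i] that(1) by simp
    show "wt k (insert i K) = alpha n + wt m K" using that fin by (simp add: wt_def)
    show "even (card (insert i K)) = odd (card K)" using that(1) fin by simp
  qed (rule that(2))
  \<comment> \<open>In the last case \<open>n + 3 \<le> m + 1\<close>, so the range allowed for
    \<open>n\<close> is exactly large enough for the induction.\<close>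
  consider "m = n" | "m = n + 1" | "n = m + 1" | "n + 2 \<le> m" using less.prems by linarith
  then show ?case
  proof cases
    case 1
    have "K \<subseteq> {..<n}" using Km 1 by force
    then have "sbracket True (even (card K)) (V n) (b * V m)
        = sg (odd (card K)) (b * X (n + 1) * V (n + 3) + b * X (n + 1) * V (n + 3))"
      using 1 by (simp add: sbracket_V_below[OF b] anticomm_same mult_2 distrib_left mult.assoc)
    also have "\<dots> \<in> rop.span (cone n (alpha n + wt m K) (odd (card K)))"
    proof -
      have "b * X (n + 1) * V (n + 3) \<in> rop.span (cone n (alpha n + wt m K) (odd (card K)))"
      proof (rule base)
        show "n + 1 \<notin> K" using Km[of "n + 1"] 1 by auto
        show "standard (n + 3) (insert (n + 1) K \<union> L)" if "L \<subseteq> {j. j + 2 \<le> n}" for L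
          using that Km 1 by (fastforce simp: standard_def)
        show "alpha (n + 3) - alpha (n + 1) = alpha n + alpha m" using 1 by (simp add: alpha_rec)
      qed
      then show ?thesis by (intro span_sg rop.span_add)
    qed
    finally show ?thesis .
  next
    case 2
    have "K \<subseteq> {..<n}" using Km 2 by force
    then have "sbracket True (even (card K)) (V n) (b * V m)
        = sg (even (card K)) (b * X n * V (n + 3))"
      using 2 anticomm_1[of n, where 'a = 'k] by (simp add: sbracket_V_below[OF b] mult.assoc)
    also have "\<dots> \<in> rop.span (cone n (alpha n + wt m K) (odd (card K)))"
    proof (rule span_sg, rule base)
      show "n \<notin> K" using Km[of n] 2 by auto
      show "standard (n + 3) (insert n K \<union> L)" if "L \<subseteq> {j. j + 2 \<le> n}" for L
        using that Km 2 by (fastforce simp: standard_def)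
      show "alpha (n + 3) - alpha n = alpha n + alpha m" using 2 by (simp add: alpha_rec)
    qed
    finally show ?thesis .
  next
    case 3
    have ac: "(anticomm n m :: 'k rop) = - (X m * V (m + 3))"
      unfolding 3 anticomm_commute[of "m + 1" m] by (rule anticomm_1)
    have "K \<subseteq> {..<n}" using Km 3 by force
    then have "sbracket True (even (card K)) (V n) (b * V m)
        = sg (even (card K)) (b * X m * V (m + 3))"
      using ac by (simp add: sbracket_V_below[OF b] mult.assoc)
    also have "\<dots> \<in> rop.span (cone n (alpha n + wt m K) (odd (card K)))"
    proof (rule span_sg, rule base)
      show "m \<notin> K" using Km[of m] by auto
      show "standard (m + 3) (insert m K \<union> L)" if "L \<subseteq> {j. j + 2 \<le> n}" for L
        using that Km 3 by (fastforce simp: standard_def)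
      show "alpha (m + 3) - alpha m = alpha n + alpha m" using 3 by (simp add: alpha_rec)
    qed
    finally show ?thesis .
  next
    case 4
    let ?p = "even (card K)"
    have "sbracket True ?p (V n) (b * V m)
        = sbracket True ?p (D n) (b * V m) + X n * X (n + 1) * sbracket True ?p (V (n + 3)) (b * V m)"
      by (intro sbracket_V_step mon_V_X_comm[OF b]) (use 4 in auto)
    moreover have "sbracket True ?p (D n) (b * V m) \<in> rop.span (cone n (alpha n + wt m K) (odd (card K)))"
    proof (cases "n \<in> K")
      case True
      then obtain c where c: "mon (K - {n}) c" and eq: "sbracket True ?p (D n) (b * V m) = c * V m"
        using sbracket_D[OF b _ True, of m] 4 by auto
      show ?thesis
        unfolding eq
      proof (rule rop.span_base, rule coneI[OF c])
        show "standard m (K - {n} \<union> L)" if "L \<subseteq> {j. j + 2 \<le> n}" for L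
          by (rule standard_remove_Un[OF K True that])
        show "wt m (K - {n}) = alpha n + wt m K"
          using True fin by (simp add: wt_def sum_diff1)
        show "even (card (K - {n})) = odd (card K)"
          using True fin by (metis card_Suc_Diff1 even_Suc)
      qed
    next
      case False
      then show ?thesis using sbracket_D_zero[OF b _ False, of m] 4 by (simp add: rop.span_zero)
    qed
    moreover have "X n * X (n + 1) * sbracket True ?p (V (n + 3)) (b * V m)
        \<in> rop.span (cone n (alpha n + wt m K) (odd (card K)))"
    proof -
      \<comment> \<open>The larger index \<open>n + 1\<close> is the highest one that the cone at
        \<open>n + 3\<close> leaves room for.\<close>
      have "mon {n, n + 1} (X n * X (n + 1) :: 'k rop)"
        using mon_mult[OF mon_single mon_single, of n "n + 1"] by (simp add: insert_commute)
      moreover have "sbracket True ?p (V (n + 3)) (b * V m)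
          \<in> rop.span (cone (n + 3) (alpha (n + 3) + wt m K) (odd (card K)))"
        using less.hyps[of "n + 3"] 4 by auto
      ultimately have "X n * X (n + 1) * sbracket True ?p (V (n + 3)) (b * V m)
        \<in> rop.span (cone n (alpha (n + 3) + wt m K - sum alpha {n, n + 1}) (odd (card K) \<noteq> odd (card {n, n + 1})))"
        by (intro cone_mult[where n' = "n + 3"]) auto
      moreover have "alpha (n + 3) + wt m K - sum alpha {n, n + 1} = alpha n + wt m K" by (simp add: alpha_rec)
      moreover have "(odd (card K) \<noteq> odd (card {n, n + 1})) = odd (card K)" by simp
      ultimately show ?thesis by (simp only:)
    qed
    ultimately show ?thesis by (simp add: rop.span_add)
  qed
qed

definition good :: "bool \<Rightarrow> 'k::field rop set" where
  "good p = {a * V k |k M a. mon M a \<and> standard k M \<and> 0 \<le> wt k M \<and> even (card M) = p}"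

lemma cone_good:
  assumes "0 \<le> w"
  shows "cone 0 w p \<subseteq> good p"
proof
  fix x :: "'a rop"
  assume "x \<in> cone 0 w p"
  then obtain k M a where "x = a * V k" "mon M a" "standard k (M \<union> {})" "wt k M = w" "even (card M) = p"
    unfolding cone_def by blast
  with assms show "x \<in> good p" unfolding good_def by auto
qed

text \<open>\<open>J\<close> fits into the room of the cone at \<open>n\<close>, so \<open>a\<close>
  can be multiplied back; the weight of the result is the sum of two nonnegative weights.\<close>

lemma good_bracket_le:
  assumes a: "mon J a" "standard n J" "0 \<le> wt n J" and b: "mon K b" "standard m K" "0 \<le> wt m K" and le: "n \<le> m"
  shows "sbracket (even (card J)) (even (card K)) (a * V n) (b * V m)
    \<in> rop.span (good (even (card J) \<noteq> even (card K)))"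
proof -
  have J: "J \<subseteq> {j. j + 2 \<le> n}" using a(2) by (force simp: standard_def)
  have "a * sbracket True (even (card K)) (V n) (b * V m)
      \<in> rop.span (cone 0 (alpha n + wt m K - sum alpha J) (odd (card K) \<noteq> odd (card J)))"
    by (rule cone_mult[OF a(1) J]) (use V_bracket_cone[OF b(1,2)] le in auto)
  moreover have "cone 0 (alpha n + wt m K - sum alpha J) (odd (card K) \<noteq> odd (card J))
      \<subseteq> good (even (card J) \<noteq> even (card K))"
  proof -
    have "(odd (card K) \<noteq> odd (card J)) = (even (card J) \<noteq> even (card K))" by blast
    then show ?thesis using a(3) b(3) by (simp add: wt_def cone_good)
  qed
  ultimately have "a * sbracket True (even (card K)) (V n) (b * V m)
      \<in> rop.span (good (even (card J) \<noteq> even (card K)))"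
    using rop.span_mono by blast
  moreover have "J \<subseteq> {..<m}" using J le by force
  ultimately show ?thesis by (simp add: sbracket_mon_left[OF a(1) _ b(1)])
qed

lemma good_bracket:
  assumes "x \<in> good p" "y \<in> good q"
  shows "sbracket p q x y \<in> rop.span (good (p \<noteq> q))"
proof -
  obtain n J a where x: "x = a * V n" and a: "mon J a" "standard n J" "0 \<le> wt n J" "even (card J) = p"
    using assms(1) unfolding good_def by blast
  obtain m K b where y: "y = b * V m" and b: "mon K b" "standard m K" "0 \<le> wt m K" "even (card K) = q"
    using assms(2) unfolding good_def by blast
  show ?thesis
  proof (cases "n \<le> m")
    case True
    then show ?thesis using good_bracket_le[OF a(1-3) b(1-3)] unfolding x y a(4) b(4) by simp
  next
    case False
    then have "sbracket q p y x \<in> rop.span (good (p \<noteq> q))"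
      using good_bracket_le[OF b(1-3) a(1-3)] unfolding x y a(4) b(4) by (simp add: eq_commute)
    then show ?thesis by (subst sbracket_flip) (rule span_sg)
  qed
qed

inductive bracket_word_rop :: "'k::field rop \<Rightarrow> bool \<Rightarrow> bool" where
  bracket_word_rop_gen: "i \<le> 2 \<Longrightarrow> bracket_word_rop (V i) True"
| bracket_word_rop_br: "bracket_word_rop a p \<Longrightarrow> bracket_word_rop b q \<Longrightarrow> bracket_word_rop (sbracket p q a b) (p \<noteq> q)"

lemma bracket_word_rop_good: "bracket_word_rop (a :: 'k::field rop) p \<Longrightarrow> a \<in> rop.span (good p)"
proof (induction rule: bracket_word_rop.induct)
  case (bracket_word_rop_gen i)
  then consider "i = 0" | "i = 1" | "i = 2" by linarith
  then have "0 \<le> alpha i" by cases (auto simp: numeral_2_eq_2)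
  then have "1 * V i \<in> (good True :: 'k rop set)" unfolding good_def
    using mon_one by (fastforce simp: standard_def wt_def)
  then show ?case by (simp add: rop.span_base)
next
  case (bracket_word_rop_br a p b q)
  then show ?case by (intro sbracket_span[OF good_bracket])
qed

text \<open>The parities are kept apart because the sign in a supercommutator depends on
  them.\<close>

definition Qpart :: "bool \<Rightarrow> 'k::field rop set" where
  "Qpart p = rop.span {a. bracket_word_rop a p}"

lemma Qpart_br: "x \<in> Qpart p \<Longrightarrow> y \<in> Qpart q \<Longrightarrow> sbracket p q x y \<in> Qpart (p \<noteq> q)"
  unfolding Qpart_def
proof (rule sbracket_span)
  fix a b :: "'a rop"
  assume "a \<in> {a. bracket_word_rop a p}" "b \<in> {a. bracket_word_rop a q}"
  then have "bracket_word_rop (sbracket p q a b) (p \<noteq> q)" by (intro bracket_word_rop_br) auto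
  then show "sbracket p q a b \<in> rop.span {a. bracket_word_rop a (p \<noteq> q)}" by (intro rop.span_base) simp
qed

subsection \<open>Generation by the first three pivots\<close>

text \<open>One signed monomial suffices, since any other with the same support differs by a sign
  (\<open>inQ_mon\<close>). The first argument fixes the field, which \<open>M\<close> and
  \<open>k\<close> do not mention.\<close>

definition inQ :: "'k::field itself \<Rightarrow> nat set \<Rightarrow> nat \<Rightarrow> bool" where
  "inQ _ M k \<longleftrightarrow> (\<exists>a :: 'k rop. mon M a \<and> a * V k \<in> Qpart (even (card M)))"

context
  fixes K :: "'k::field itself"
  assumes char2: "(2 :: 'k) \<noteq> 0"
begin

abbreviation "Q \<equiv> inQ K"

lemma inQ_mon:
  assumes "Q M k" "mon M (a :: 'k rop)"
  shows "a * V k \<in> Qpart (even (card M))"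
proof -
  obtain b :: "'k rop" where b: "mon M b" "b * V k \<in> Qpart (even (card M))"
    using assms(1) unfolding inQ_def by blast
  obtain p where "a = sg p b" using mon_unique[OF b(1) assms(2)] by blast
  with b(2) show ?thesis unfolding Qpart_def by (simp add: span_sg)
qed

text \<open>Since \<open>J\<close> and \<open>L\<close> lie below both pivots, the supercommutator
  is \<open>a * b\<close> times the anticommutator of the pivots up to sign, and \<open>r\<close>
  can be divided out.\<close>

lemma inQ_bracket:
  assumes J: "Q J n" and L: "Q L m" and disj: "J \<inter> L = {}" "(J \<union> L) \<inter> N = {}"
    and below: "J \<union> L \<subseteq> {..<n}" "J \<union> L \<subseteq> {..<m}"
    and N: "mon N (c :: 'k rop)" "odd (card N)" and anticomm: "anticomm n m = rscale r (c * V k)" and r: "r \<noteq> 0"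
  shows "Q (J \<union> L \<union> N) k"
proof -
  obtain a :: "'k rop" where a: "mon J a" "a * V n \<in> Qpart (even (card J))"
    using J unfolding inQ_def by blast
  obtain b :: "'k rop" where b: "mon L b" "b * V m \<in> Qpart (even (card L))"
    using L unfolding inQ_def by blast
  have fin: "finite J" "finite L" "finite N" using mon_finite a(1) b(1) N(1) by auto
  have par: "even (card (J \<union> L \<union> N)) = (even (card J) \<noteq> even (card L))"
    using disj fin N(2) by (auto simp: card_Un_disjoint)
  have m: "mon (J \<union> L \<union> N) (a * b * c)"
    by (intro mon_mult a b N disj)
  have "sg (odd (card L)) (a * b * anticomm n m) \<in> Qpart (even (card (J \<union> L \<union> N)))"
    using Qpart_br[OF a(2) b(2)] below sbracket_below[OF a(1) b(1), of m n] unfolding par by simp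
  then have "sg (odd (card L)) (sg (odd (card L)) (a * b * anticomm n m)) \<in> Qpart (even (card (J \<union> L \<union> N)))"
    unfolding Qpart_def by (rule span_sg)
  then have "rscale r (a * b * c * V k) \<in> Qpart (even (card (J \<union> L \<union> N)))"
    by (simp add: anticomm rscale_mult_right mult.assoc)
  then have "rscale (inverse r) (rscale r (a * b * c * V k)) \<in> Qpart (even (card (J \<union> L \<union> N)))"
    unfolding Qpart_def by (rule rop.span_scale)
  then have "a * b * c * V k \<in> Qpart (even (card (J \<union> L \<union> N)))" using r by simp
  with m show ?thesis unfolding inQ_def by blast
qed

text \<open>Turns the coefficient 2 into a scalar, which \<open>char2\<close> makes
  invertible.\<close>

lemma rscale_2: "2 * a = rscale 2 (a :: 'k rop)"
  using rop.scale_left_distrib[of 1 1 a] by (simp add: mult_2)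

lemma inQ_bracket1:
  assumes "Q J n" "Q L (n + 1)" "J \<inter> L = {}" "J \<union> L \<subseteq> {..<n}"
  shows "Q (J \<union> L \<union> {n}) (n + 3)"
proof (rule inQ_bracket[OF assms(1-3) _ assms(4) _ mon_single])
  show "anticomm n (n + 1) = rscale (- 1) (X n * V (n + 3) :: 'k rop)" by (simp only: anticomm_1 rop.scale_minus_left rop.scale_one)
qed (use assms in auto)

lemma inQ_bracket2:
  assumes "Q J n" "Q L (n + 2)" "J \<inter> L = {}" "J \<union> L \<subseteq> {..<n}"
  shows "Q (J \<union> L \<union> {n, n + 1, n + 2}) (n + 5)"
proof (rule inQ_bracket[OF assms(1-3) _ assms(4)])
  show "mon {n, n + 1, n + 2} (X n * (X (n + 1) * X (n + 2)) :: 'k rop)"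
    by (intro mon_X mon_single) auto
  show "anticomm n (n + 2) = rscale (- 1) (X n * (X (n + 1) * X (n + 2)) * V (n + 5) :: 'k rop)"
    by (simp only: anticomm_2 rop.scale_minus_left rop.scale_one mult.assoc)
qed (use assms in auto)

lemma inQ_bracket_same:
  assumes "Q J n" "Q L n" "J \<inter> L = {}" "J \<union> L \<subseteq> {..<n}"
  shows "Q (J \<union> L \<union> {n + 1}) (n + 3)"
proof (rule inQ_bracket[OF assms(1-3) _ assms(4,4) mon_single])
  show "anticomm n n = rscale 2 (X (n + 1) * V (n + 3) :: 'k rop)" by (simp only: anticomm_same rscale_2)
qed (use assms char2 in auto)

lemma inQ_bracket3:
  assumes "Q {} n" "Q L (n + 3)" "L \<subseteq> {..<n}"
  shows "Q (L \<union> {n, n + 1, n + 4}) (n + 6)"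
proof -
  have "Q ({} \<union> L \<union> {n, n + 1, n + 4}) (n + 6)"
  proof (rule inQ_bracket[OF assms(1,2)])
    show "mon {n, n + 1, n + 4} (X n * (X (n + 1) * X (n + 4)) :: 'k rop)"
      by (intro mon_X mon_single) auto
    show "anticomm n (n + 3) = rscale 2 (X n * (X (n + 1) * X (n + 4)) * V (n + 6) :: 'k rop)"
      by (simp only: anticomm_3 rscale_2 mult.assoc)
    show "{} \<union> L \<subseteq> {..<n + 3}" using assms(3) by force
  qed (use assms char2 in auto)
  then show ?thesis by simp
qed

lemma inQ_remove:
  assumes "Q {} n" "Q M m" "n \<in> M" "n < m"
  shows "Q (M - {n}) m"
proof -
  obtain b :: "'k rop" where b: "mon M b" "b * V m \<in> Qpart (even (card M))"
    using assms(2) unfolding inQ_def by blast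
  obtain c where c: "mon (M - {n}) c" "sbracket True (even (card M)) (V n) (b * V m) = c * V m"
    using sbracket_V_hit[OF b(1) assms(4,3)] by blast
  have "V n \<in> (Qpart True :: 'k rop set)" using inQ_mon[OF assms(1) mon_one] by simp
  from Qpart_br[OF this b(2)] have "c * V m \<in> Qpart (odd (card M))" by (simp add: c(2))
  moreover have "even (card (M - {n})) = odd (card M)"
    using assms(3) mon_finite[OF b(1)] by (metis card_Suc_Diff1 even_Suc)
  ultimately show ?thesis using c(1) unfolding inQ_def by auto
qed

text \<open>The bracket of \<open>V i\<close> and \<open>V (i + 1)\<close> gives
  \<open>x_i v_{i+3}\<close> up to sign, and a second bracket with \<open>V i\<close> strips
  \<open>x_i\<close>.\<close>

lemma inQ_V: "Q {} n"
proof (induction n rule: less_induct)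
  case (less n)
  show ?case
  proof (cases "n < 3")
    case True
    then have "V n \<in> (Qpart True :: 'k rop set)"
      unfolding Qpart_def by (intro rop.span_base) (auto intro: bracket_word_rop_gen)
    then show ?thesis unfolding inQ_def using mon_one by (intro exI[of _ 1]) simp
  next
    case False
    then obtain i where i: "n = i + 3" using le_Suc_ex by (metis add.commute not_less)
    have "Q ({} \<union> {} \<union> {i}) (i + 3)" by (rule inQ_bracket1) (auto intro: less simp: i)
    then have "Q ({i} - {i}) (i + 3)" using less[of i] i by (intro inQ_remove) auto
    then show ?thesis by (simp add: i)
  qed
qed

lemma inQ_remove': "Q (insert n M) m \<Longrightarrow> n < m \<Longrightarrow> n \<notin> M \<Longrightarrow> Q M m"
  using inQ_remove[OF inQ_V, of "insert n M" m n] by simp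

text \<open>With \<open>N = n + 3\<close>, \<open>M\<close> is enlarged to contain \<open>n\<close>,
  and also \<open>n - 2\<close> if it contains \<open>n - 1\<close>. The enlarged monomial is a
  bracket of lower ones, and pivots strip the added factors. The second form is needed because
  \<open>x_{n-1} v_{n+1}\<close> is not of the first type.\<close>

lemma inQ_first: "(N, M) \<in> idx1 \<Longrightarrow> Q M N"
proof (induction N arbitrary: M rule: less_induct)
  case (less N)
  have M: "j + 3 \<le> N" if "j \<in> M" for j using less.prems that by (auto simp: idx1_def)
  have ex: "\<not> (N = 4 \<and> 0 \<in> M)" "\<not> (N = 7 \<and> 0 \<in> M \<and> 3 \<in> M)" using less.prems by (auto simp: idx1_def)
  have IH: "Q R i" if "i < N" "\<And>j. j \<in> R \<Longrightarrow> j + 3 \<le> i" "\<not> (i = 4 \<and> 0 \<in> R)" "\<not> (i = 7 \<and> 0 \<in> R \<and> 3 \<in> R)" for i R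
  proof (rule less.IH[OF that(1)])
    show "(i, R) \<in> idx1" using that(2-4) by (force simp: idx1_def)
  qed
  have zero: "Q {0} i" if "i < N" "3 \<le> i" "i \<noteq> 4" for i
    by (rule IH) (use that in auto)
  show ?case
  proof (cases "N < 3")
    case True
    then have "M = {}" using M by force
    then show ?thesis by (simp add: inQ_V)
  next
    case False
    then obtain n where n: "N = n + 3" using le_Suc_ex by (metis add.commute not_less)
    show ?thesis
    proof (cases "\<exists>i. n = i + 1 \<and> i \<in> M")
      case True
      then obtain i' where i': "n = i' + 1" "i' \<in> M" by blast
      \<comment> \<open>\<open>i' = 0\<close> would give the excluded monomials containing
        \<open>x_0 v_4\<close>.\<close>
      have "i' \<noteq> 0" using ex(1) i' n by (cases i') auto
      then obtain i where i: "n = i + 2" "i + 1 \<in> M" using i' by (cases i') auto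
      define R where "R = M - {i, i + 1, i + 2}"
      have R: "j < i" if "j \<in> R" for j using M[of j] that by (auto simp: R_def n i)
      \<comment> \<open>For \<open>n = 7\<close> the lower factor \<open>x_R v_7\<close> may be
        exceptional, so \<open>x_0\<close> is moved to the other factor, giving
        \<open>x_0 v_5\<close>.\<close>
      have top: "Q (R \<union> {i, i + 1, i + 2}) (i + 5)"
      proof (cases "n = 7 \<and> 0 \<in> R")
        case True
        have "Q {0} i" using True i n by (intro zero) auto
        moreover have "Q (R - {0}) (i + 2)" using True i n R by (intro IH) force+
        ultimately have "Q ({0} \<union> (R - {0}) \<union> {i, i + 1, i + 2}) (i + 5)"
          using R True i by (intro inQ_bracket2) auto
        moreover have "{0} \<union> (R - {0}) = R" using True by auto
        ultimately show ?thesis by (simp only:)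
      next
        case False
        have "Q R (i + 2)"
        proof (rule IH)
          \<comment> \<open>Here \<open>N = 7\<close> and \<open>3 \<in> M\<close>, so
            \<open>0 \<notin> M\<close> by the exclusion at length 7.\<close>
          show "\<not> (i + 2 = 4 \<and> 0 \<in> R)" using ex(2) i n by (auto simp: R_def)
        qed (use False i n R in force)+
        then have "Q ({} \<union> R \<union> {i, i + 1, i + 2}) (i + 5)"
          using R by (intro inQ_bracket2 inQ_V) auto
        then show ?thesis by simp
      qed
      have "R \<union> {i, i + 1, i + 2} = M \<union> {i, i + 2}" using i(2) by (auto simp: R_def)
      then have "Q (insert i (insert (i + 2) M)) (i + 5)" using top by simp
      then have "Q (insert (i + 2) M) (i + 5)"
        using inQ_remove'[of i "insert (i + 2) M" "i + 5"] by (cases "i \<in> M") (auto simp: insert_absorb insert_commute)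
      then have "Q M (i + 5)"
        using inQ_remove'[of "i + 2" M "i + 5"] by (cases "i + 2 \<in> M") (auto simp: insert_absorb)
      then show ?thesis by (simp add: n i add.commute)
    next
      case False
      define R where "R = M - {n}"
      have R: "j + 2 \<le> n" if "j \<in> R" for j
      proof -
        have "j \<le> n" "j \<noteq> n" using M[of j] that by (auto simp: R_def n)
        moreover have "n \<noteq> j + 1" using False that by (auto simp: R_def)
        ultimately show ?thesis by linarith
      qed
      \<comment> \<open>For \<open>n = 3\<close> or \<open>n = 6\<close> the factor with pivot
        \<open>n + 1\<close> may be exceptional because of \<open>x_0\<close>, which is then
        attached to \<open>V n\<close> instead.\<close>
      have top: "Q (R \<union> {n}) (n + 3)"
      proof (cases "(n = 3 \<or> n = 6) \<and> 0 \<in> R")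
        case True
        have "Q {0} n" using True n by (intro zero) auto
        moreover have "Q (R - {0}) (n + 1)" using True n R by (intro IH) force+
        ultimately have "Q ({0} \<union> (R - {0}) \<union> {n}) (n + 3)"
          using R True by (intro inQ_bracket1) force+
        moreover have "{0} \<union> (R - {0}) = R" using True by auto
        ultimately show ?thesis by (simp only:)
      next
        case False
        have "Q R (n + 1)" by (rule IH) (use False n R in force)+
        then have "Q ({} \<union> R \<union> {n}) (n + 3)"
          using R by (intro inQ_bracket1 inQ_V) force+
        then show ?thesis by simp
      qed
      have "R \<union> {n} = insert n M" by (auto simp: R_def)
      then have "Q M (n + 3)"
        using top inQ_remove'[of n M "n + 3"] by (cases "n \<in> M") (auto simp: insert_absorb)
      then show ?thesis by (simp add: n)
    qed
  qed
qed

text \<open>With \<open>N = i + 6\<close>, the highest possible index \<open>i + 1\<close> of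
  \<open>M\<close> arises from the bracket of \<open>V i\<close> with \<open>x_R v_{i+3}\<close>.
  Without it, \<open>M\<close> lies below \<open>i + 1\<close> and a bracket of two monomials with
  pivot \<open>i + 3\<close> suffices.\<close>

lemma inQ_second:
  assumes "(N, M) \<in> idx2"
  shows "Q (insert (N - 2) M) N"
proof (cases "N < 6")
  case True
  then obtain n where n: "N = n + 3" "M = {}" using assms by (auto simp: idx2_def)
  have "Q ({} \<union> {} \<union> {n + 1}) (n + 3)" by (intro inQ_bracket_same inQ_V) auto
  then show ?thesis by (simp add: n)
next
  case False
  then obtain i where i: "N = i + 6" using le_Suc_ex by (metis add.commute not_less)
  have M: "j < i + 2" if "j \<in> M" for j using assms that False by (force simp: idx2_def i)
  have ex: "\<not> (N = 7 \<and> 0 \<in> M)" "\<not> (N = 10 \<and> {0, 3, 5} \<subseteq> M)" using assms by (auto simp: idx2_def)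
  show ?thesis
  proof (cases "i + 1 \<in> M")
    case True
    define R where "R = M - {i, i + 1}"
    have R: "j < i" if "j \<in> R" for j using M[of j] that by (auto simp: R_def)
    \<comment> \<open>The exceptions at \<open>i + 3 = 4\<close> and \<open>i + 3 = 7\<close>
      correspond to those excluded for \<open>N = 7\<close> and \<open>N = 10\<close>, as
      \<open>i + 1 \<in> M\<close>.\<close>
    have "(i + 3, R) \<in> idx1" using R ex True by (force simp: idx1_def R_def i)
    then have "Q (R \<union> {i, i + 1, i + 4}) (i + 6)"
      using R by (intro inQ_bracket3 inQ_V inQ_first) auto
    moreover have "R \<union> {i, i + 1, i + 4} = insert i (insert (i + 4) M)"
      using True by (auto simp: R_def)
    ultimately have "Q (insert i (insert (i + 4) M)) (i + 6)" by simp
    then have "Q (insert (i + 4) M) (i + 6)"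
      using inQ_remove'[of i "insert (i + 4) M" "i + 6"]
      by (cases "i \<in> M") (auto simp: insert_absorb insert_commute)
    then show ?thesis by (simp add: i add.commute)
  next
    case False
    have M': "j < i + 1" if "j \<in> M" for j using M[OF that] False that by (cases "j = i + 1") auto
    \<comment> \<open>For \<open>i = 4\<close> the factor \<open>x_M v_7\<close> may be exceptional;
      \<open>x_0\<close> is then attached to the other copy of \<open>V 7\<close>.\<close>
    have "Q (M \<union> {i + 3 + 1}) (i + 3 + 3)"
    proof (cases "i = 4 \<and> 0 \<in> M")
      case True
      have "Q {0} (i + 3)" by (rule inQ_first) (use True in \<open>auto simp: idx1_def\<close>)
      moreover have "Q (M - {0}) (i + 3)" by (rule inQ_first) (use True M' in \<open>force simp: idx1_def\<close>)
      ultimately have "Q ({0} \<union> (M - {0}) \<union> {i + 3 + 1}) (i + 3 + 3)"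
        using M' by (intro inQ_bracket_same) force+
      moreover have "{0} \<union> (M - {0}) = M" using True by auto
      ultimately show ?thesis by (simp only:)
    next
      case False
      have "Q M (i + 3)" by (rule inQ_first) (use False ex M' i in \<open>force simp: idx1_def\<close>)
      then have "Q ({} \<union> M \<union> {i + 3 + 1}) (i + 3 + 3)"
        using M' by (intro inQ_bracket_same inQ_V) force+
      then show ?thesis by simp
    qed
    then show ?thesis by (simp add: i numeral_eq_Suc)
  qed
qed

end

subsection \<open>Weights of the exceptional monomials\<close>

lemma alpha_nonneg: "0 \<le> alpha n"
  by (induction n rule: alpha.induct) auto

definition alpha_sum :: "nat \<Rightarrow> int" where
  "alpha_sum n = (\<Sum>j<n. alpha j)"

text \<open>Summing the recursion leaves no constant, since it already holds at
  \<open>n = 0\<close>. Differences of \<open>alpha\<close> and \<open>alpha_sum\<close> therefore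
  solve the same recursion.\<close>

lemma alpha_sum_rec: "alpha_sum (n + 3) = 2 * alpha_sum n + alpha_sum (n + 1)"
proof (induction n)
  case 0
  then show ?case by (simp add: alpha_sum_def numeral_eq_Suc)
next
  case (Suc n)
  then show ?case by (simp add: alpha_sum_def numeral_eq_Suc)
qed

lemma recurrence_nonneg:
  fixes f :: "nat \<Rightarrow> int"
  assumes "\<And>m. f (m + 3) = 2 * f m + f (m + 1)" "0 \<le> f k" "0 \<le> f (k + 1)" "0 \<le> f (k + 2)"
  shows "0 \<le> f (k + m)"
proof (induction m rule: less_induct)
  case (less m)
  show ?case
  proof (cases "m < 3")
    case True
    then have "m = 0 \<or> m = 1 \<or> m = 2" by auto
    then show ?thesis using assms by auto
  next
    case False
    then obtain i where "m = i + 3" by (metis add.commute le_Suc_ex not_less)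
    then show ?thesis using assms(1)[of "k + i"] less[of i] less[of "i + 1"] by (simp add: add.assoc)
  qed
qed

text \<open>\<open>alpha_sum (n - 2)\<close> is what the full tail subtracts. The difference of the
  two sides solves the recursion and starts with 3, 1, 1 at \<open>n = 8, 9, 10\<close>; at
  \<open>n = 7\<close> it is -1.\<close>

lemma alpha_sum_first: "8 \<le> n \<Longrightarrow> alpha_sum (n - 2) \<le> alpha n"
proof -
  assume "8 \<le> n"
  then obtain m where n: "n = 6 + m + 2" using le_Suc_ex[of 8 n] by auto
  have "0 \<le> alpha (6 + m + 2) - alpha_sum (6 + m)"
  proof (rule recurrence_nonneg[where f = "\<lambda>m. alpha (m + 2) - alpha_sum m"])
    show "alpha (i + 3 + 2) - alpha_sum (i + 3) = 2 * (alpha (i + 2) - alpha_sum i) + (alpha (i + 1 + 2) - alpha_sum (i + 1))" for i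
      using alpha_rec[of "i + 2"] alpha_sum_rec[of i] by (simp add: add.commute add.left_commute)
  qed (simp_all add: alpha_sum_def numeral_eq_Suc)
  then show ?thesis by (simp add: n)
qed

text \<open>The same argument for the second type: the difference starts with 7, 9, 5 at
  \<open>n = 11, 12, 13\<close>, while it is -1 at \<open>n = 10\<close>.\<close>

lemma alpha_sum_second: "11 \<le> n \<Longrightarrow> alpha_sum (n - 4) + alpha (n - 2) \<le> alpha n"
proof -
  assume "11 \<le> n"
  then obtain m where n: "n = 7 + m + 4" using le_Suc_ex[of 11 n] by auto
  have "0 \<le> alpha (7 + m + 4) - alpha (7 + m + 2) - alpha_sum (7 + m)"
  proof (rule recurrence_nonneg[where f = "\<lambda>m. alpha (m + 4) - alpha (m + 2) - alpha_sum m"])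
    show "alpha (i + 3 + 4) - alpha (i + 3 + 2) - alpha_sum (i + 3)
        = 2 * (alpha (i + 4) - alpha (i + 2) - alpha_sum i) + (alpha (i + 1 + 4) - alpha (i + 1 + 2) - alpha_sum (i + 1))" for i
      using alpha_rec[of "i + 4"] alpha_rec[of "i + 2"] alpha_sum_rec[of i] by (simp add: add.commute add.left_commute)
  qed (simp_all add: alpha_sum_def numeral_eq_Suc)
  then show ?thesis by (simp add: n)
qed

lemma sum_alpha_explicit:
  assumes "M \<subseteq> {..<6}"
  shows "sum alpha M = (if 0 \<in> M then 1 else 0) + (if 3 \<in> M then 2 else 0) + (if 5 \<in> M then 2 else 0)"
proof -
  have "sum alpha M = (\<Sum>j<6. if j \<in> M then alpha j else 0)"
    using assms by (simp add: sum.inter_restrict[symmetric] Int_absorb1)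
  then show ?thesis by (simp add: numeral_eq_Suc)
qed

lemma alpha_values:
  "alpha 1 = 0" "alpha 2 = 0" "alpha 3 = 2" "alpha 4 = 0" "alpha 5 = 2" "alpha 6 = 4" "alpha 7 = 2" "alpha 8 = 8" "alpha 9 = 10" "alpha 10 = 12"
  by (simp_all add: numeral_eq_Suc)

lemma sum_alpha_le: "M \<subseteq> {..<n} \<Longrightarrow> sum alpha M \<le> alpha_sum n"
  unfolding alpha_sum_def by (rule sum_mono2) (auto simp: alpha_nonneg)

lemma wt_first:
  assumes M: "M \<subseteq> {..<n - 2}"
  shows "0 \<le> wt n M \<longleftrightarrow> \<not> (n = 4 \<and> 0 \<in> M) \<and> \<not> (n = 7 \<and> 0 \<in> M \<and> 3 \<in> M)"
proof (cases "8 \<le> n")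
  case True
  then show ?thesis using alpha_sum_first[of n] sum_alpha_le[OF M] by (auto simp: wt_def)
next
  case False
  then have M6: "M \<subseteq> {..<6}" using M by force
  have m: "0 \<in> M \<Longrightarrow> 3 \<le> n" "3 \<in> M \<Longrightarrow> 6 \<le> n" "5 \<in> M \<Longrightarrow> 8 \<le> n" using M by auto
  have "n \<in> {0, 1, 2, 3, 4, 5, 6, 7}" using False by auto
  then show ?thesis unfolding wt_def sum_alpha_explicit[OF M6] using m
    by (elim insertE emptyE) (auto simp: alpha_values)
qed

text \<open>From \<open>n = 11\<close> on even the longest tail has nonnegative weight; below that a
  finite check remains. The case \<open>n = 5\<close> is \<open>x_0 x_3 v_5\<close>, which
  \<open>idx2\<close> rules out by \<open>J = {}\<close>.\<close>

lemma wt_second: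
  assumes J: "J \<subseteq> {..<n - 4}" and n: "3 \<le> n"
  shows "0 \<le> wt n (insert (n - 2) J)
    \<longleftrightarrow> \<not> (n = 5 \<and> 0 \<in> J) \<and> \<not> (n = 7 \<and> 0 \<in> J) \<and> \<not> (n = 10 \<and> {0, 3, 5} \<subseteq> J)"
proof -
  have "n - 2 \<notin> J" "finite J" using J n finite_subset[OF J] by auto
  then have wt: "wt n (insert (n - 2) J) = alpha n - alpha (n - 2) - sum alpha J" by (simp add: wt_def)
  show ?thesis
  proof (cases "11 \<le> n")
    case True
    then show ?thesis using alpha_sum_second[of n] sum_alpha_le[OF J] by (auto simp: wt)
  next
    case False
    then have J6: "J \<subseteq> {..<6}" using J by force
    have m: "0 \<in> J \<Longrightarrow> 5 \<le> n" "3 \<in> J \<Longrightarrow> 8 \<le> n" "5 \<in> J \<Longrightarrow> 10 \<le> n" using J by auto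
    have "n \<in> {3, 4, 5, 6, 7, 8, 9, 10}" using n False by auto
    then show ?thesis unfolding wt sum_alpha_explicit[OF J6] using m
      by (elim insertE emptyE) (auto simp: alpha_values)
  qed
qed

fun key :: "(nat \<times> nat set) + (nat \<times> nat set) \<Rightarrow> nat \<times> nat set" where
  "key (Inl (n, J)) = (n, J)"
| "key (Inr (n, J)) = (n, insert (n - 2) J)"

text \<open>The support contains \<open>n - 2\<close> for the second type and never for the first,
  so it determines the type.\<close>

lemma inj_key: "inj_on key std_index"
proof (rule inj_onI)
  have 2: "n \<ge> 3" "J \<subseteq> {..<n - 4}" if "(n, J) \<in> idx2" for n J
    using that by (auto simp: idx2_def)
  have 1: "n - 2 \<notin> J" if "(n, J) \<in> idx1" for n J using that by (auto simp: idx1_def)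
  have 3: "n - 2 \<notin> J" if "(n, J) \<in> idx2" for n J using 2[OF that] by auto
  fix a b
  assume "a \<in> std_index" "b \<in> std_index" "key a = key b"
  then show "a = b" unfolding std_index_def
    using 1 3 by (auto simp: insert_ident dest: 1 3)
qed

lemma key_surj:
  assumes "standard n M" "0 \<le> wt n M"
  obtains a where "a \<in> std_index" "key a = (n, M)"
proof (cases "\<forall>j\<in>M. j + 3 \<le> n")
  case True
  then have M: "M \<subseteq> {..<n - 2}" by force
  then have "(n, M) \<in> idx1" using wt_first[OF M] assms(2) by (simp add: idx1_def atLeast0LessThan)
  then show ?thesis using that[of "Inl (n, M)"] by (auto simp: std_index_def)
next
  case False
  then obtain i where i: "i \<in> M" "\<not> i + 3 \<le> n" by blast
  have 2: "j + 5 \<le> n \<or> j + 2 = n" if "j \<in> M" for j using assms(1) False that by (auto simp: standard_def)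
  then have i2: "i + 2 = n" using i by force
  define J where "J = M - {n - 2}"
  have M: "M = insert (n - 2) J" using i(1) i2 by (auto simp: J_def)
  have J: "J \<subseteq> {..<n - 4}" using 2 by (force simp: J_def)
  \<comment> \<open>The remaining shape \<open>x_0 v_2\<close> has weight -1.\<close>
  have n: "3 \<le> n"
  proof (rule ccontr)
    assume "\<not> 3 \<le> n"
    then have "n = 2" "M = {0}" using i2 J M by auto
    then show False using assms(2) by (simp add: wt_def numeral_2_eq_2)
  qed
  have w: "\<not> (n = 5 \<and> 0 \<in> J) \<and> \<not> (n = 7 \<and> 0 \<in> J) \<and> \<not> (n = 10 \<and> {0, 3, 5} \<subseteq> J)"
    using wt_second[OF J n] assms(2) M by simp
  have "(n, J) \<in> idx2"
  proof (cases "6 \<le> n")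
    case True
    then show ?thesis using J w by (auto simp: idx2_def)
  next
    case False
    then have "n \<in> {3, 4, 5}" using n by auto
    \<comment> \<open>For \<open>n = 5\<close> the only other choice is \<open>J = {0}\<close>,
      excluded by weight.\<close>
    moreover have "J = {}" using J w False n by (cases "n = 5") auto
    ultimately show ?thesis by (auto simp: idx2_def)
  qed
  then show ?thesis using that[of "Inr (n, J)"] M by (auto simp: std_index_def)
qed

lemma std_mon_eq:
  assumes "a \<in> std_index" "key a = (n, M)"
  obtains x :: "'k::field rop" where "mon M x" "std_mon a = Rep_rop (x * V n)"
proof (cases a)
  case (Inl c)
  then have c: "c = (n, M)" using assms(2) by (cases c) auto
  have "finite M" using assms(1) Inl c by (auto simp: std_index_def idx1_def intro: finite_subset)
  then have "mon M (Xs (sorted_list_of_set M) :: 'k rop)" using mon_Xs[of "sorted_list_of_set M"] by simp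
  then show ?thesis
    by (rule that) (simp add: Inl c std_mon_def std1_def times_rop.rep_eq V.rep_eq Rep_rop_Xs)
next
  case (Inr c)
  then obtain J where c: "c = (n, J)" "M = insert (n - 2) J" using assms(2) by (cases c) auto
  have i: "(n, J) \<in> idx2" using assms(1) Inr c by (auto simp: std_index_def)
  then have J: "J \<subseteq> {..<n - 4}" "3 \<le> n" by (auto simp: idx2_def)
  then have "finite J" "n - 2 \<notin> J" using finite_subset[OF J(1)] by auto
  then have "mon M (Xs (sorted_list_of_set J @ [n - 2]) :: 'k rop)"
    using mon_Xs[of "sorted_list_of_set J @ [n - 2]", where 'a = 'k] by (simp del: Xs_simps add: c(2))
  then show ?thesis
    by (rule that) (simp add: Inr c std_mon_def std2_def times_rop.rep_eq V.rep_eq Rep_rop_Xs del: Xs_simps)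
qed

subsection \<open>Linear independence\<close>

lemma mon_row:
  "mon M x \<Longrightarrow> Rep_rop x {} U \<noteq> 0 \<longleftrightarrow> U = M"
proof (induction arbitrary: U rule: mon.induct)
  case mon_one
  then show ?case by (simp add: one_rop.rep_eq op_id_def)
next
  case (mon_X M a i)
  have "Rep_rop (X i * a) {} U = Rep_rop a {} M * Rep_rop (X i) M U"
    unfolding times_rop.rep_eq by (rule op_comp_single) (use mon_X.IH in blast)
  then show ?case
    using mon_X.IH[of M] mon_finite[OF mon_X.hyps(1)] mon_X.hyps(2)
    by (simp add: X_apply sgn_below_def)
next
  case (mon_neg M a)
  then show ?case by (simp add: uminus_rop.rep_eq)
qed

lemma mon_V_row_less: "n < k \<Longrightarrow> Rep_rop (x * V k) {n} U = 0"
  using kills_mult[OF V_kills[of "{n}" k], of x] by (simp add: kills_def)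

text \<open>\<open>V n\<close> sends \<open>x_n\<close> to 1, because \<open>V (n + 3)\<close>
  annihilates \<open>x_n\<close>. Hence \<open>x * V n\<close> sends \<open>x_n\<close> to
  \<open>x_M\<close> up to sign.\<close>

lemma mon_V_row:
  assumes "mon M x"
  shows "Rep_rop (x * V n) {n} U \<noteq> 0 \<longleftrightarrow> U = M"
proof -
  have "x * V n = x * D n + x * X n * X (n + 1) * V (n + 3)"
    by (subst V_rec) (simp add: distrib_left mult.assoc)
  then have "Rep_rop (x * V n) {n} U = Rep_rop (x * D n) {n} U"
    by (simp add: plus_rop.rep_eq mon_V_row_less)
  also have "\<dots> = Rep_rop x {} U"
  proof -
    have "{j \<in> {n}. j < n} = {}" by auto
    then have "sgn_below n {n} = (1 :: 'a)" unfolding sgn_below_def by (simp only: card.empty power_0)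
    then show ?thesis by (simp add: mult_D_apply)
  qed
  finally show ?thesis using mon_row[OF assms] by simp
qed

lemma key_determined:
  fixes x y :: "'k::field rop"
  assumes "mon M x" "mon N y" "x * V n = y * V m"
  shows "n = m \<and> M = N"
proof -
  have "n = m"
    using mon_V_row[OF assms(1), of n M] mon_V_row[OF assms(2), of m N] assms(3)
      mon_V_row_less[of n m y M] mon_V_row_less[of m n x N]
    by (metis linorder_neqE_nat)
  moreover have "M = N"
    using mon_V_row[OF assms(1), of n M] mon_V_row[OF assms(2), of m M] assms(3) \<open>n = m\<close> by simp
  ultimately show ?thesis by simp
qed

lemma inj_std_mon: "inj_on (std_mon :: _ \<Rightarrow> 'k::field op) std_index"
proof (rule inj_onI)
  fix a b
  assume a: "a \<in> std_index" and b: "b \<in> std_index" and eq: "(std_mon a :: 'k op) = std_mon b"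
  obtain n M m N where k: "key a = (n, M)" "key b = (m, N)" by (metis surj_pair)
  obtain x :: "'k rop" where x: "mon M x" "std_mon a = Rep_rop (x * V n)" using std_mon_eq[OF a k(1)] .
  obtain y :: "'k rop" where y: "mon N y" "std_mon b = Rep_rop (y * V m)" using std_mon_eq[OF b k(2)] .
  have "x * V n = y * V m" using x(2) y(2) eq by (simp add: Rep_rop_inject)
  then have "key a = key b" using key_determined[OF x(1) y(1)] k by simp
  then show "a = b" using inj_key a b by (auto dest: inj_onD)
qed

text \<open>In a vanishing combination, row \<open>{n}\<close> and column \<open>M\<close> isolate
  the coefficient with key \<open>(n, M)\<close>: larger pivots annihilate \<open>x_n\<close>, the
  same pivot with another support hits another column, and smaller pivots have coefficient 0 by
  induction.\<close>

lemma independent_std_mon: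
  "op.independent (std_mon ` std_index :: 'k::field op set)"
  unfolding op.independent_explicit_module
proof (intro allI impI)
  fix t :: "'k op set" and u v
  assume t: "finite t" "t \<subseteq> std_mon ` std_index" and zero: "(\<Sum>v\<in>t. op_scale (u v) v) = 0" and v: "v \<in> t"
  have "u (std_mon a) = 0" if "a \<in> std_index" "std_mon a \<in> t" "key a = (n, M)" for a n M
    using that
  proof (induction n arbitrary: a M rule: less_induct)
    case (less n)
    obtain x :: "'k rop" where x: "mon M x" "std_mon a = Rep_rop (x * V n)"
      using std_mon_eq[OF less.prems(1,3)] .
    have other: "u w * w {n} M = 0" if w: "w \<in> t" "w \<noteq> std_mon a" for w
    proof -
      obtain b where b: "b \<in> std_index" "w = std_mon b" using w(1) t(2) by blast
      obtain m N where k: "key b = (m, N)" by fastforce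
      obtain y :: "'k rop" where y: "mon N y" "std_mon b = Rep_rop (y * V m)" using std_mon_eq[OF b(1) k] .
      consider "m < n" | "n < m" | "m = n" by linarith
      then show ?thesis
      proof cases
        case 1
        then show ?thesis using less.IH[OF _ b(1) _ k] b(2) w(1) by simp
      next
        case 2
        then show ?thesis using mon_V_row_less[OF 2, of y M] by (simp add: b(2) y(2))
      next
        case 3
        have "key a \<noteq> key b" using w(2) b(1,2) less.prems(1) inj_key by (auto dest: inj_onD)
        then have "M \<noteq> N" using 3 k less.prems(3) by simp
        then show ?thesis using mon_V_row[OF y(1), of m M] 3 by (simp add: b(2) y(2))
      qed
    qed
    have "(\<Sum>w\<in>t. op_scale (u w) w) {n} M = (\<Sum>w\<in>t. u w * w {n} M)"
      using t(1) by (induction t rule: finite_induct) (auto simp: op_scale_def)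
    then have "0 = (\<Sum>w\<in>t. u w * w {n} M)" by (simp add: zero)
    also have "\<dots> = u (std_mon a) * (std_mon a :: 'k op) {n} M"
    proof -
      have "(\<Sum>w\<in>t - {std_mon a}. u w * w {n} M) = 0" by (rule sum.neutral) (use other in blast)
      then show ?thesis
        using sum.remove[OF t(1) less.prems(2), of "\<lambda>w. u w * w {n} M"] by simp
    qed
    finally show ?case using mon_V_row[OF x(1), of n M] x(2) by simp
  qed
  moreover obtain a where "a \<in> std_index" "v = std_mon a" using v t(2) by blast
  ultimately show "u v = 0" using v by (cases "key a") blast
qed

section \<open>Transfer to matrices and the basis of the generated algebra\<close>

lemma bracket_word_iff: "bracket_word A p \<longleftrightarrow> (\<exists>a. A = Rep_rop a \<and> bracket_word_rop a p)"
proof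
  show "bracket_word A p \<Longrightarrow> \<exists>a. A = Rep_rop a \<and> bracket_word_rop a p"
  proof (induction rule: bracket_word.induct)
    case (gen i)
    then show ?case by (metis V.rep_eq bracket_word_rop_gen)
  next
    case (br A p B q)
    then show ?case by (metis Rep_rop_sbracket bracket_word_rop_br)
  qed
  have "bracket_word_rop a p \<Longrightarrow> bracket_word (Rep_rop a) p" for a :: "'a rop"
  proof (induction rule: bracket_word_rop.induct)
    case (bracket_word_rop_gen i)
    then show ?case by (simp add: V.rep_eq bracket_word.gen)
  next
    case (bracket_word_rop_br a p b q)
    then show ?case unfolding Rep_rop_sbracket by (intro bracket_word.br)
  qed
  then show "\<exists>a. A = Rep_rop a \<and> bracket_word_rop a p \<Longrightarrow> bracket_word A p" by blast
qed

lemma Qalg_eq: "(Qalg :: 'k::field op set) = Rep_rop ` rop.span {a. \<exists>p. bracket_word_rop a p}"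
proof -
  have "{A :: 'k op. \<exists>p. bracket_word A p} = Rep_rop ` {a. \<exists>p. bracket_word_rop a p}"
    by (auto simp: bracket_word_iff)
  then show ?thesis by (simp add: Qalg_def Rep_rop.span_image)
qed

theorem theorem5p1:
  assumes "(2::'k::field) \<noteq> 0"
  shows "inj_on (std_mon :: _ \<Rightarrow> 'k op) std_index
       \<and> module.independent (op_scale :: 'k \<Rightarrow> 'k op \<Rightarrow> 'k op) (std_mon ` std_index)
       \<and> module.span (op_scale :: 'k \<Rightarrow> 'k op \<Rightarrow> 'k op) (std_mon ` std_index) = Qalg"
proof (intro conjI inj_std_mon independent_std_mon)
  \<comment> \<open>The copy of the standard monomials in the ring type; spans are compared there
    and carried back along the linear map \<open>Rep_rop\<close>.\<close>
  define B :: "'k rop set" where "B = Rep_rop -` (std_mon ` std_index)"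
  have "std_mon ` std_index = Rep_rop ` B"
  proof -
    have "(std_mon a :: 'k op) \<in> range Rep_rop" if "a \<in> std_index" for a
      using std_mon_eq[OF that, of "fst (key a)" "snd (key a)", where 'k = 'k] by (metis prod.collapse rangeI)
    then show ?thesis unfolding B_def image_vimage_eq by blast
  qed
  then have "op.span (std_mon ` std_index :: 'k op set) = Rep_rop ` rop.span B"
    by (simp add: Rep_rop.span_image)
  moreover have "rop.span B = rop.span {a. \<exists>p. bracket_word_rop a p}"
  proof (rule subset_antisym)
    have "b \<in> rop.span {a. \<exists>p. bracket_word_rop a p}" if "b \<in> B" for b
    proof -
      obtain a where a: "a \<in> std_index" "Rep_rop b = std_mon a" using \<open>b \<in> B\<close> by (auto simp: B_def)
      obtain n M where k: "key a = (n, M)" by fastforce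
      obtain x :: "'k rop" where x: "mon M x" "std_mon a = Rep_rop (x * V n)" using std_mon_eq[OF a(1) k] .
      have b: "b = x * V n" using a(2) x(2) by (simp add: Rep_rop_inject)
      have "inQ TYPE('k) M n"
        using a(1) k inQ_first[OF assms] inQ_second[OF assms] by (auto simp: std_index_def)
      then have "b \<in> Qpart (even (card M))" unfolding b by (rule inQ_mon[OF assms _ x(1)])
      moreover have "Qpart (even (card M)) \<subseteq> rop.span {a :: 'k rop. \<exists>p. bracket_word_rop a p}"
        unfolding Qpart_def by (rule rop.span_mono) auto
      ultimately show ?thesis by (rule subsetD[rotated])
    qed
    then show "rop.span B \<subseteq> rop.span {a. \<exists>p. bracket_word_rop a p}" by (intro rop.span_minimal) auto
    \<comment> \<open>By \<open>key_surj\<close> the elements of \<open>good p\<close> are standard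
      monomials up to sign.\<close>
    have "good p \<subseteq> rop.span B" for p
    proof
      fix g :: "'k rop"
      assume "g \<in> good p"
      then obtain k M y where g: "g = y * V k" "mon M y" "standard k M" "0 \<le> wt k M"
        unfolding good_def by blast
      obtain a where a: "a \<in> std_index" "key a = (k, M)" using key_surj[OF g(3,4)] .
      obtain x :: "'k rop" where x: "mon M x" "std_mon a = Rep_rop (x * V k)" using std_mon_eq[OF a] .
      obtain s where "y = sg s x" using mon_unique[OF x(1) g(2)] by blast
      moreover have "x * V k \<in> B" unfolding B_def x(2)[symmetric] using a(1) by (simp add: x(2)[symmetric])
      ultimately show "g \<in> rop.span B" by (simp add: g(1) span_sg rop.span_base)
    qed
    then have "rop.span (good p) \<subseteq> rop.span B" for p
      by (rule rop.span_minimal) (rule rop.subspace_span)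
    then have "a \<in> rop.span B" if "bracket_word_rop a p" for a p
      using bracket_word_rop_good[OF that] by (rule subsetD)
    then show "rop.span {a. \<exists>p. bracket_word_rop a p} \<subseteq> rop.span B" by (intro rop.span_minimal) auto
  qed
  ultimately show "op.span (std_mon ` std_index :: 'k op set) = Qalg" by (simp add: Qalg_eq)
qed

end
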